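(* For every finite abelian group $A$ there is a compact manifold with embedded corners $X$ (all faces connected) such that the conormal homology $H^{cn}_*(X)$ contains a subgroup isomorphic to $A$.
   Context: A compact smooth manifold with embedded corners $X$ is given by a compact smooth manifold $\widetilde X$ without boundary and smooth maps $\rho_1,\dots,\rho_n\colon\widetilde X\to\mathbb{R}$ such that, with $X:=\bigcap_{j=1}^n\rho_j^{-1}([0,\infty))\subseteq\widetilde X$ (non-empty) and $H_j:=\rho_j^{-1}(0)\cap X$, for every $J\subseteq\{1,\dots,n\}$ the differentials $\{d\rho_j\}_{j\in J}$ have maximal rank $|J|$ (are linearly independent) at each point of $H_J:=\bigcap_{j\in J}H_j$ (with $H_\emptyset:=X$). The sets $H_j$, which are assumed non-empty, are the boundary components of codimension $1$; the non-empty $H_J$ with $|J|=k$ are the faces of codimension $k$. "All faces connected" means that every face of every codimension (including $X$ itself, the only face of codimension $0$) is connected. Conormal homology $H^{cn}_*(X)$ is the homology of the following chain complex. $C_p(X)$ is the abelian group generated by symbols $f\otimes\varepsilon$, where $f=H_{j_1}\cap\dots\cap H_{j_p}$ is a (connected) face of codimension $p$ and $\varepsilon$ is an orientation of its conormal bundle, i.e. $\varepsilon=\pm e_{j_1}\wedge\dots\wedge e_{j_p}$ with $e_j$ the conormal class of $d\rho_j$, subject to $f\otimes(-\varepsilon)=-f\otimes\varepsilon$. The differential $C_p(X)\to C_{p-1}(X)$ is given by contraction: $$f\otimes(e_{j_1}\wedge\dots\wedge e_{j_p})\mapsto\sum_{i=1}^p(-1)^{i-1}\,f_i\otimes(e_{j_1}\wedge\dots\wedge\widehat{e_{j_i}}\wedge\dots\wedge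 e_{j_p}),$$ where $f_i=\bigcap_{l\ne i}H_{j_l}$ is the codimension $p-1$ face obtained by omitting $H_{j_i}$. *)

theory Defs
  imports
    "HOL-Analysis.Analysis"
    "HOL-Algebra.Free_Abelian_Groups"
    "HOL-Algebra.Product_Groups"
begin

section \<open>Smooth manifolds\<close>

text \<open>
  The model space of dimension \<open>d\<close> is \<^const>\<open>Euclidean_space\<close> \<open>d\<close>, i.e. the functions
  \<open>nat \<Rightarrow> real\<close> vanishing at all \<open>i \<ge> d\<close>; this keeps the dimension a term.
\<close>

definition partial_deriv :: "nat \<Rightarrow> ((nat \<Rightarrow> real) \<Rightarrow> real) \<Rightarrow> (nat \<Rightarrow> real) \<Rightarrow> real"
  where "partial_deriv i f x = deriv (\<lambda>t. f (x(i := t))) (x i)"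

primrec iterated_partial :: "nat list \<Rightarrow> ((nat \<Rightarrow> real) \<Rightarrow> real) \<Rightarrow> (nat \<Rightarrow> real) \<Rightarrow> real"
  where
    "iterated_partial [] f = f"
  | "iterated_partial (i # is) f = partial_deriv i (iterated_partial is f)"

text \<open>
  \<open>C\<^sup>\<infinity>\<close> in the usual sense: all partial derivatives of all orders exist and are continuous.
  This is meant for \<open>V\<close> open in \<open>\<real>\<^sup>d\<close>; the values of \<open>f\<close> outside \<open>V\<close> are then irrelevant.
\<close>

definition smooth_on_Euclidean :: "nat \<Rightarrow> (nat \<Rightarrow> real) set \<Rightarrow> ((nat \<Rightarrow> real) \<Rightarrow> real) \<Rightarrow> bool"
  where "smooth_on_Euclidean d V f \<longleftrightarrow>
    (\<forall>is. set is \<subseteq> {..<d} \<longrightarrow>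
      continuous_map (subtopology (Euclidean_space d) V) euclideanreal (iterated_partial is f) \<and>
      (\<forall>x\<in>V. \<forall>i<d. (\<lambda>t. iterated_partial is f (x(i := t))) differentiable (at (x i))))"

type_synonym 'a chart = "'a set \<times> ('a \<Rightarrow> nat \<Rightarrow> real)"

definition is_chart :: "nat \<Rightarrow> 'a topology \<Rightarrow> 'a chart \<Rightarrow> bool"
  where "is_chart d T c \<longleftrightarrow> (case c of (U, \<phi>) \<Rightarrow>
    openin T U \<and> openin (Euclidean_space d) (\<phi> ` U) \<and>
    homeomorphic_map (subtopology T U) (subtopology (Euclidean_space d) (\<phi> ` U)) \<phi>)"

definition smooth_atlas :: "nat \<Rightarrow> 'a topology \<Rightarrow> 'a chart set \<Rightarrow> bool"
  where "smooth_atlas d T \<A> \<longleftrightarrow>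
    (\<forall>c\<in>\<A>. is_chart d T c) \<and>
    topspace T = (\<Union>(U, \<phi>)\<in>\<A>. U) \<and>
    (\<forall>(U, \<phi>)\<in>\<A>. \<forall>(V, \<psi>)\<in>\<A>. \<forall>k<d.
      smooth_on_Euclidean d (\<phi> ` (U \<inter> V)) (\<lambda>y. \<psi> (inv_into U \<phi> y) k))"

definition smooth_manifold :: "nat \<Rightarrow> 'a topology \<Rightarrow> 'a chart set \<Rightarrow> bool"
  where "smooth_manifold d T \<A> \<longleftrightarrow>
    Hausdorff_space T \<and> second_countable T \<and> smooth_atlas d T \<A>"

definition smooth_function :: "nat \<Rightarrow> 'a chart set \<Rightarrow> ('a \<Rightarrow> real) \<Rightarrow> bool"
  where "smooth_function d \<A> f \<longleftrightarrow>
    (\<forall>(U, \<phi>)\<in>\<A>. smooth_on_Euclidean d (\<phi> ` U) (f \<circ> inv_into U \<phi>))"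

text \<open>The coordinates of the differential of \<open>f\<close> at \<open>x\<close> in a chart around \<open>x\<close>.\<close>

definition differential_in_chart :: "'a chart \<Rightarrow> ('a \<Rightarrow> real) \<Rightarrow> 'a \<Rightarrow> nat \<Rightarrow> real"
  where "differential_in_chart c f x i =
    (case c of (U, \<phi>) \<Rightarrow> partial_deriv i (f \<circ> inv_into U \<phi>) (\<phi> x))"

text \<open>
  Linear independence of the family (not just the set) of differentials at \<open>x\<close>. By the chain
  rule the condition does not depend on the chart, so it is asked in all charts around \<open>x\<close>.
\<close>

definition independent_differentials ::
    "nat \<Rightarrow> 'a chart set \<Rightarrow> (nat \<Rightarrow> 'a \<Rightarrow> real) \<Rightarrow> nat set \<Rightarrow> 'a \<Rightarrow> bool"
  where "independent_differentials d \<A> \<rho> J x \<longleftrightarrow>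
    (\<forall>c\<in>\<A>. x \<in> fst c \<longrightarrow>
      (\<forall>a :: nat \<Rightarrow> real.
        (\<forall>i<d. (\<Sum>j\<in>J. a j * differential_in_chart c (\<rho> j) x i) = 0) \<longrightarrow> (\<forall>j\<in>J. a j = 0)))"


section \<open>Manifolds with embedded corners\<close>

record 'a corner_data =
  ambient :: "'a topology"
  dimension :: nat
  atlas :: "'a chart set"
  num :: nat
  rho :: "nat \<Rightarrow> 'a \<Rightarrow> real"

definition corner_space :: "'a corner_data \<Rightarrow> 'a set"
  where "corner_space X = {x \<in> topspace (ambient X). \<forall>j\<in>{1..num X}. 0 \<le> rho X j x}"

definition hyperface :: "'a corner_data \<Rightarrow> nat \<Rightarrow> 'a set"
  where "hyperface X j = {x \<in> corner_space X. rho X j x = 0}"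

text \<open>Intersecting with \<open>corner_space X\<close> only matters for \<open>J = {}\<close>, where \<open>H\<^sub>J = X\<close>.\<close>

definition face :: "'a corner_data \<Rightarrow> nat set \<Rightarrow> 'a set"
  where "face X J = corner_space X \<inter> (\<Inter>j\<in>J. hyperface X j)"

definition compact_manifold_with_embedded_corners :: "'a corner_data \<Rightarrow> bool"
  where "compact_manifold_with_embedded_corners X \<longleftrightarrow>
    smooth_manifold (dimension X) (ambient X) (atlas X) \<and>
    compact_space (ambient X) \<and>
    (\<forall>j\<in>{1..num X}. smooth_function (dimension X) (atlas X) (rho X j)) \<and>
    corner_space X \<noteq> {} \<and>
    (\<forall>j\<in>{1..num X}. hyperface X j \<noteq> {}) \<and>
    (\<forall>J\<subseteq>{1..num X}. \<forall>x\<in>face X J.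
      independent_differentials (dimension X) (atlas X) (rho X) J x)"

definition all_faces_connected :: "'a corner_data \<Rightarrow> bool"
  where "all_faces_connected X \<longleftrightarrow>
    (\<forall>J\<subseteq>{1..num X}. face X J \<noteq> {} \<longrightarrow> connectedin (ambient X) (face X J))"


section \<open>Conormal homology\<close>

text \<open>
  The symbol \<open>f \<otimes> \<epsilon>\<close> with \<open>f = H\<^sub>J\<close> and \<open>\<epsilon> = s \<cdot> e\<^bsub>j\<^sub>1\<^esub> \<and> \<dots> \<and> e\<^bsub>j\<^sub>p\<^esub>\<close>, where \<open>j\<^sub>1 < \<dots> < j\<^sub>p\<close> are the
  elements of \<open>J\<close> and \<open>s = \<plusminus>1\<close>, is encoded as the pair \<open>(J, s)\<close>. Non-empty faces \<open>H\<^sub>J\<close> and \<open>H\<^sub>K\<close>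
  with \<open>J \<noteq> K\<close> are distinct by the rank condition, so \<open>J\<close> and the face determine each other.
\<close>

type_synonym oriented_face = "nat set \<times> int"

definition oriented_faces :: "'a corner_data \<Rightarrow> nat \<Rightarrow> oriented_face set"
  where "oriented_faces X p =
    {J. J \<subseteq> {1..num X} \<and> card J = p \<and> face X J \<noteq> {}} \<times> {1, - 1}"

definition orientation_relations ::
    "'a corner_data \<Rightarrow> nat \<Rightarrow> (oriented_face \<Rightarrow>\<^sub>0 int) set"
  where "orientation_relations X p =
    generate (free_Abelian_group (oriented_faces X p))
      ((\<lambda>(J, s). frag_of (J, - s) + frag_of (J, s)) ` oriented_faces X p)"

definition conormal_chains ::
    "'a corner_data \<Rightarrow> nat \<Rightarrow> (oriented_face \<Rightarrow>\<^sub>0 int) set monoid"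
  where "conormal_chains X p =
    free_Abelian_group (oriented_faces X p) Mod orientation_relations X p"

text \<open>If \<open>j\<close> is the \<open>i\<close>-th element of \<open>J\<close>, then \<open>card {l \<in> J. l < j} = i - 1\<close>.\<close>

definition contraction :: "oriented_face \<Rightarrow> (oriented_face \<Rightarrow>\<^sub>0 int)"
  where "contraction = (\<lambda>(J, s).
    \<Sum>j\<in>J. frag_cmul ((- 1) ^ card {l \<in> J. l < j}) (frag_of (J - {j}, s)))"

text \<open>
  The map induced on the quotients; the cosets in the union all coincide. In degree \<open>0\<close>, where
  the target is \<open>C\<^bsub>-1\<^esub> = 0\<close>, this is the zero map into \<open>C\<^sub>0\<close> (as \<open>0 - 1 = 0\<close> in \<open>nat\<close> and
  \<open>contraction ({}, s) = 0\<close>), so that the kernel is all of \<open>C\<^sub>0\<close> as it should be.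
\<close>

definition conormal_differential ::
    "'a corner_data \<Rightarrow> nat \<Rightarrow> (oriented_face \<Rightarrow>\<^sub>0 int) set \<Rightarrow> (oriented_face \<Rightarrow>\<^sub>0 int) set"
  where "conormal_differential X p K =
    (\<Union>c\<in>K. orientation_relations X (p - 1)
       #>\<^bsub>free_Abelian_group (oriented_faces X (p - 1))\<^esub> frag_extend contraction c)"

definition conormal_cycles :: "'a corner_data \<Rightarrow> nat \<Rightarrow> (oriented_face \<Rightarrow>\<^sub>0 int) set set"
  where "conormal_cycles X p =
    kernel (conormal_chains X p) (conormal_chains X (p - 1)) (conormal_differential X p)"

definition conormal_boundaries :: "'a corner_data \<Rightarrow> nat \<Rightarrow> (oriented_face \<Rightarrow>\<^sub>0 int) set set"
  where "conormal_boundaries X p =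
    conormal_differential X (Suc p) ` carrier (conormal_chains X (Suc p))"

definition conormal_homology_degree ::
    "'a corner_data \<Rightarrow> nat \<Rightarrow> (oriented_face \<Rightarrow>\<^sub>0 int) set set monoid"
  where "conormal_homology_degree X p =
    (conormal_chains X p)\<lparr>carrier := conormal_cycles X p\<rparr> Mod conormal_boundaries X p"

text \<open>The total group \<open>H\<^sub>* = \<Oplus>\<^sub>p H\<^sub>p\<close>.\<close>

definition conormal_homology ::
    "'a corner_data \<Rightarrow> (nat \<Rightarrow> (oriented_face \<Rightarrow>\<^sub>0 int) set set) monoid"
  where "conormal_homology X = sum_group UNIV (conormal_homology_degree X)"

end

theory Submission
  imports Defs
begin

text \<open>
The conormal complex depends only on which intersections \<open>H\<^sub>J\<close> are non-empty: it is the augmented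
simplicial chain complex of the nerve of the hypersurfaces, shifted by one. So it suffices to find
a simplicial complex with \<open>A\<close> inside its first homology, and a manifold with connected faces whose
nerve it is.

\<^emph>\<open>The complex.\<close> The two-dimensional skeleton of a classifying space of \<open>A\<close> has three vertices
\<open>0, 1, 2\<close>, an edge for every \<open>g \<in> A\<close> over each of the pairs \<open>01\<close>, \<open>12\<close>, \<open>02\<close>, and a triangle for
every \<open>(g, h)\<close>, bounded by the edges \<open>g\<close>, \<open>h\<close> and \<open>g h\<close>. Its barycentric subdivision is a simplicial
complex: a simplex is a chain of cells. The differences of two edges over \<open>01\<close> are loops, and the
triangles make \<open>g \<mapsto> loop g\<close> a homomorphism into the first homology (\<open>loop_filling\<close>). Conversely
the \<open>A\<close>-covering of the complex is recorded by an \<open>A\<close>-valued cocycle (\<open>holonomy_cocycle\<close>) whose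
value on \<open>loop g\<close> is \<open>g\<close>. A homomorphism with a left inverse is injective, which is what
\<open>embeds_in_conormal_homology\<close> turns into a subgroup of the conormal homology.

\<^emph>\<open>The manifold.\<close> All ambient manifolds are round spheres, and all \<open>\<rho>\<^sub>j\<close> are affine,
\<open>\<rho>\<^sub>j(x) = t - \<langle>a\<^sub>j, x\<rangle>\<close>, where \<open>a\<^sub>j\<close> ignores the last two coordinates of the sphere. A face is then
a union of circles, one over each point of the convex set in which a face of a polyhedron meets the unit
ball, the circle shrinking to a point on the boundary of the ball. Hence faces are connected
(\<open>connected_face\<close>), and which of them are non-empty is a question about distances from the origin
to the faces of a polyhedron. The rank condition can fail only where the point nearest to the origin in
the affine span of such a face lies on the unit sphere (\<open>independent_differentials_corners\<close>).

It remains to choose the vectors. Given a graph, take vectors \<open>a\<^sub>j\<close> of equal length with scalar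
product \<open>1\<close> along the edges of the graph and \<open>0\<close> otherwise. The face of a triple \<open>J\<close> is the closer to the origin
the longer \<open>\<Sum>\<^bsub>j\<in>J\<^esub> a\<^sub>j\<close> is, that is, the more edges the triple contains; for a suitable \<open>t\<close> exactly the
triangles of the graph survive, together with all pairs (\<open>triangle_complex_spherical_corners\<close>).
For the incidence graph of the cells above, the triangles are exactly the two-dimensional simplices
of the subdivision. The superfluous pairs only add edges to a two-dimensional complex, which adds
no boundaries and therefore does not affect the injectivity of \<open>g \<mapsto> loop g\<close>.
\<close>


section \<open>Smoothness of rational functions\<close>

text \<open>
Partial derivatives of rational functions are rational, so for these functions smoothness reduces
to continuity and to a single differentiation. Stereographic charts involve no other functions.
\<close>

inductive_set rational_functions :: "(nat \<Rightarrow> real) set \<Rightarrow> ((nat \<Rightarrow> real) \<Rightarrow> real) set"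
  for V where
  const: "(\<lambda>x. c) \<in> rational_functions V"
| coord: "(\<lambda>x. x i) \<in> rational_functions V"
| add: "f \<in> rational_functions V \<Longrightarrow> g \<in> rational_functions V \<Longrightarrow> (\<lambda>x. f x + g x) \<in> rational_functions V"
| mult: "f \<in> rational_functions V \<Longrightarrow> g \<in> rational_functions V \<Longrightarrow> (\<lambda>x. f x * g x) \<in> rational_functions V"
| inverse: "f \<in> rational_functions V \<Longrightarrow> (\<And>x. x \<in> V \<Longrightarrow> f x \<noteq> 0)
    \<Longrightarrow> (\<lambda>x. inverse (f x)) \<in> rational_functions V"

lemma rational_functions_uminus:
  "f \<in> rational_functions V \<Longrightarrow> (\<lambda>x. - f x) \<in> rational_functions V"
  using rational_functions.mult[OF rational_functions.const[of "-1"]] by simp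

lemma rational_functions_diff:
  "f \<in> rational_functions V \<Longrightarrow> g \<in> rational_functions V \<Longrightarrow> (\<lambda>x. f x - g x) \<in> rational_functions V"
  using rational_functions.add[OF _ rational_functions_uminus] by fastforce

lemma rational_functions_divide:
  "f \<in> rational_functions V \<Longrightarrow> g \<in> rational_functions V \<Longrightarrow> (\<And>x. x \<in> V \<Longrightarrow> g x \<noteq> 0)
    \<Longrightarrow> (\<lambda>x. f x / g x) \<in> rational_functions V"
  unfolding divide_inverse by (intro rational_functions.mult rational_functions.inverse)

lemma rational_functions_power:
  "f \<in> rational_functions V \<Longrightarrow> (\<lambda>x. f x ^ n) \<in> rational_functions V"
  by (induction n) (auto intro: rational_functions.intros)

lemma rational_functions_sum:
  "(\<And>i. i \<in> I \<Longrightarrow> f i \<in> rational_functions V) \<Longrightarrow> (\<lambda>x. \<Sum>i\<in>I. f i x) \<in> rational_functions V"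
  by (induction I rule: infinite_finite_induct) (auto intro: rational_functions.intros)

lemmas rational_functions_intros =
  rational_functions.intros rational_functions_uminus rational_functions_diff
  rational_functions_divide rational_functions_power rational_functions_sum

lemma continuous_on_rational_function:
  "f \<in> rational_functions V \<Longrightarrow> continuous_on V f"
proof (induction rule: rational_functions.induct)
  case (coord i)
  show ?case by (rule continuous_on_product_coordinates[THEN continuous_on_subset]) auto
qed (auto intro!: continuous_intros)

lemma partial_rational_function:
  assumes "f \<in> rational_functions V"
  shows "\<exists>g\<in>rational_functions V. \<forall>x\<in>V. ((\<lambda>t. f (x(i := t))) has_real_derivative g x) (at (x i))"
  using assms
proof (induction rule: rational_functions.induct)
  case (const c)
  show ?case by (rule bexI[of _ "\<lambda>x. 0"]) (auto intro: rational_functions.intros)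
next
  case (coord j)
  show ?case
    by (rule bexI[of _ "\<lambda>x. if j = i then 1 else 0"])
      (auto intro: rational_functions.intros simp: fun_upd_def)
next
  case (add f g)
  then obtain f' g' where *: "f' \<in> rational_functions V" "g' \<in> rational_functions V"
    "\<forall>x\<in>V. ((\<lambda>t. f (x(i := t))) has_real_derivative f' x) (at (x i))"
    "\<forall>x\<in>V. ((\<lambda>t. g (x(i := t))) has_real_derivative g' x) (at (x i))" by blast
  show ?case
    by (intro bexI[of _ "\<lambda>x. f' x + g' x"] rational_functions.add ballI DERIV_add
        *(3)[rule_format] *(4)[rule_format] *(1,2))
next
  case (mult f g)
  then obtain f' g' where *: "f' \<in> rational_functions V" "g' \<in> rational_functions V"
    "\<forall>x\<in>V. ((\<lambda>t. f (x(i := t))) has_real_derivative f' x) (at (x i))"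
    "\<forall>x\<in>V. ((\<lambda>t. g (x(i := t))) has_real_derivative g' x) (at (x i))" by blast
  show ?case
  proof (intro bexI[of _ "\<lambda>x. f' x * g x + g' x * f x"] ballI)
    fix x assume "x \<in> V"
    with * show "((\<lambda>t. f (x(i := t)) * g (x(i := t))) has_real_derivative f' x * g x + g' x * f x) (at (x i))"
      using DERIV_mult[of "\<lambda>t. f (x(i := t))" "f' x" "x i" UNIV "\<lambda>t. g (x(i := t))" "g' x"] by simp
  qed (intro rational_functions.add rational_functions.mult * mult.hyps)
next
  case (inverse f)
  then obtain f' where *: "f' \<in> rational_functions V"
    "\<forall>x\<in>V. ((\<lambda>t. f (x(i := t))) has_real_derivative f' x) (at (x i))" by blast
  show ?case
  proof (intro bexI[of _ "\<lambda>x. - (inverse (f x) * f' x * inverse (f x))"] ballI)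
    fix x assume "x \<in> V"
    with * inverse.hyps(2) show "((\<lambda>t. inverse (f (x(i := t)))) has_real_derivative
        - (inverse (f x) * f' x * inverse (f x))) (at (x i))"
      using DERIV_inverse'[of "\<lambda>t. f (x(i := t))" "f' x" "x i" UNIV] by simp
  qed (intro rational_functions_uminus rational_functions.mult rational_functions.inverse * inverse.hyps)
qed

text \<open>
Iterated partial derivatives at a point of \<open>V\<close> see a function only on short segments of coordinate lines,
and these stay inside \<open>V\<close>. So functions that agree on \<open>V\<close> have the same iterated derivatives there.
\<close>

lemma open_coordinate_line:
  assumes V: "openin (Euclidean_space d) V" and "x \<in> V" "i < d"
  shows "open {t. x(i := t) \<in> V}"
proof -
  obtain W where W: "open W" "V = W \<inter> {x. \<forall>i\<ge>d. x i = 0}"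
    using V unfolding Euclidean_space_def openin_subtopology euclidean_product_topology
    by (auto simp only: open_openin)
  have "{t. x(i := t) \<in> V} = (\<lambda>t. x(i := t)) -` W"
  proof -
    have "x j = 0" if "j \<ge> d" for j using W(2) \<open>x \<in> V\<close> that by blast
    then show ?thesis unfolding W(2) using \<open>i < d\<close> by auto
  qed
  moreover have "continuous_on UNIV (\<lambda>t. x(i := t))"
  proof (rule continuous_on_coordinatewise_then_product)
    show "continuous_on UNIV (\<lambda>t. (x(i := t)) j)" for j
      by (cases "j = i") auto
  qed
  ultimately show ?thesis
    using open_vimage[OF W(1)] by simp
qed

text \<open>
By induction every iterated partial derivative of \<open>f\<close> again agrees on \<open>V\<close> with a rational function.
\<close>

lemma smooth_rational_function:
  assumes V: "openin (Euclidean_space d) V"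
    and g: "g \<in> rational_functions V" and eq: "\<And>x. x \<in> V \<Longrightarrow> f x = g x"
  shows "smooth_on_Euclidean d V f"
proof -
  have near: "\<forall>\<^sub>F t in nhds (x i). x(i := t) \<in> V" if "x \<in> V" "i < d" for x i
    using eventually_nhds_in_open[OF open_coordinate_line[OF V that]] that by simp
  have rat: "\<exists>g\<in>rational_functions V. \<forall>x\<in>V. iterated_partial is f x = g x"
    if "set is \<subseteq> {..<d}" for "is"
    using that
  proof (induction "is")
    case Nil
    then show ?case using g eq by auto
  next
    case (Cons i "is")
    then obtain h where h: "h \<in> rational_functions V" "\<forall>x\<in>V. iterated_partial is f x = h x" by auto
    obtain h' where h': "h' \<in> rational_functions V"
      "\<forall>x\<in>V. ((\<lambda>t. h (x(i := t))) has_real_derivative h' x) (at (x i))"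
      using partial_rational_function[OF h(1)] by blast
    have "iterated_partial (i # is) f x = h' x" if x: "x \<in> V" for x
    proof -
      have "deriv (\<lambda>t. iterated_partial is f (x(i := t))) (x i) = deriv (\<lambda>t. h (x(i := t))) (x i)"
        by (rule deriv_cong_ev) (use near[OF x, of i] Cons.prems h in \<open>auto elim: eventually_mono\<close>)
      also have "\<dots> = h' x" using h' x by (intro DERIV_imp_deriv) auto
      finally show ?thesis by (simp add: partial_deriv_def)
    qed
    then show ?case using h'(1) by blast
  qed
  show ?thesis
    unfolding smooth_on_Euclidean_def
  proof (intro allI impI conjI ballI)
    fix "is" assume "is": "set is \<subseteq> {..<d}"
    obtain h where h: "h \<in> rational_functions V" "\<forall>x\<in>V. iterated_partial is f x = h x"
      using rat[OF "is"] by blast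
    have top: "subtopology (Euclidean_space d) V = top_of_set V"
      using openin_subset[OF V]
      by (simp add: Euclidean_space_def subtopology_subtopology euclidean_product_topology Int_absorb1)
    show "continuous_map (subtopology (Euclidean_space d) V) euclideanreal (iterated_partial is f)"
      unfolding top using continuous_on_rational_function[OF h(1)] h(2)
      by (simp add: continuous_map_iff_continuous cong: continuous_on_cong)
    fix x i assume x: "x \<in> V" and i: "i < d"
    obtain h' where "((\<lambda>t. h (x(i := t))) has_real_derivative h') (at (x i))"
      using partial_rational_function[OF h(1), of i] x by blast
    then have "((\<lambda>t. iterated_partial is f (x(i := t))) has_real_derivative h') (at (x i))"
      by (subst DERIV_cong_ev[OF refl _ refl])
        (use near[OF x i] h in \<open>auto elim: eventually_mono\<close>)
    then show "(\<lambda>t. iterated_partial is f (x(i := t))) differentiable (at (x i))"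
      using real_differentiable_def by blast
  qed
qed


section \<open>The sphere as a smooth manifold\<close>

definition norm_sq :: "nat \<Rightarrow> (nat \<Rightarrow> real) \<Rightarrow> real"
  where "norm_sq d x = (\<Sum>i<d. (x i)\<^sup>2)"

lemma norm_sq_nonneg [simp]: "0 \<le> norm_sq d x"
  by (simp add: norm_sq_def sum_nonneg)

lemma norm_sq_Suc: "norm_sq (Suc d) x = norm_sq d x + (x d)\<^sup>2"
  by (simp add: norm_sq_def)

lemma norm_sq_divide: "norm_sq d (\<lambda>i. x i / c) = norm_sq d x / c\<^sup>2"
  by (simp add: norm_sq_def power_divide sum_divide_distrib)

lemma norm_sq_cmult: "norm_sq d (\<lambda>i. c * x i) = c\<^sup>2 * norm_sq d x"
  by (simp add: norm_sq_def power_mult_distrib sum_distrib_left)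

lemma norm_sq_cong: "(\<And>i. i < d \<Longrightarrow> x i = y i) \<Longrightarrow> norm_sq d x = norm_sq d y"
  by (simp add: norm_sq_def)

lemma Euclidean_space_eq_top_of_set: "Euclidean_space d = top_of_set {x. \<forall>i\<ge>d. x i = 0}"
  by (simp add: Euclidean_space_def euclidean_product_topology)

lemma nsphere_eq_top_of_set:
  "nsphere d = top_of_set {x. norm_sq (Suc d) x = 1 \<and> (\<forall>i>d. x i = 0)}"
  by (simp add: nsphere euclidean_product_topology norm_sq_def lessThan_Suc_atMost)

lemma topspace_nsphere: "topspace (nsphere d) = {x. norm_sq (Suc d) x = 1 \<and> (\<forall>i>d. x i = 0)}"
  by (simp add: nsphere_eq_top_of_set)

text \<open>
The sphere lives in an infinite product of lines, so compactness comes from the Tychonoff theorem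
for a cube.
\<close>

lemma compact_space_nsphere: "compact_space (nsphere d)"
proof -
  define S where "S = {x. norm_sq (Suc d) x = 1 \<and> (\<forall>i>d. x i = 0)}"
  define P where "P = PiE UNIV (\<lambda>i. if i \<le> d then {-1..1::real} else {0})"
  have "compactin (product_topology (\<lambda>_. euclideanreal) UNIV) P"
    unfolding P_def by (subst compactin_PiE) auto
  then have "compact P"
    by (simp add: euclidean_product_topology)
  moreover have "closed S"
    unfolding S_def norm_sq_def
    by (intro closed_Collect_conj closed_Collect_eq closed_Collect_all closed_Collect_imp
          continuous_intros continuous_on_product_coordinates) auto
  ultimately have "compact (P \<inter> S)" by (rule compact_Int_closed)
  moreover have "S \<subseteq> P"
  proof -
    have "\<bar>x i\<bar> \<le> 1" if "norm_sq (Suc d) x = 1" "i \<le> d" for x i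
    proof -
      have "(x i)\<^sup>2 \<le> norm_sq (Suc d) x"
        unfolding norm_sq_def using that by (intro member_le_sum) auto
      then show ?thesis using that by (simp add: abs_square_le_1)
    qed
    then show ?thesis by (auto simp: S_def P_def abs_le_iff not_le)
  qed
  ultimately have "compact S" by (simp add: Int_absorb1)
  then show ?thesis by (simp add: nsphere_eq_top_of_set compact_space_subtopology S_def)
qed

lemma Hausdorff_space_nsphere: "Hausdorff_space (nsphere d)"
  by (simp add: nsphere_def Hausdorff_space_subtopology Hausdorff_Euclidean_space)

lemma second_countable_nsphere: "second_countable (nsphere d)"
proof -
  obtain B :: "(nat \<Rightarrow> real) set set" where B: "countable B" "\<And>C. C \<in> B \<Longrightarrow> open C"
    "\<And>S. open S \<Longrightarrow> \<exists>U. U \<subseteq> B \<and> S = \<Union>U"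
    using univ_second_countable by blast
  have "second_countable (euclidean :: (nat \<Rightarrow> real) topology)"
    unfolding second_countable_def
  proof (intro exI[of _ B] conjI ballI allI impI)
    fix U :: "(nat \<Rightarrow> real) set" and x assume "openin euclidean U \<and> x \<in> U"
    then show "\<exists>V\<in>B. x \<in> V \<and> V \<subseteq> U" using B(3)[of U] by auto
  qed (use B in auto)
  then show ?thesis
    by (simp add: nsphere_eq_top_of_set second_countable_subtopology)
qed

text \<open>
Projection from the pole at height \<open>\<sigma> = \<plusminus>1\<close> on the last axis \<open>d\<close>, and its inverse. Points of the
sphere have coordinates \<open>0, \<dots>, d\<close>.
\<close>

definition stereo :: "nat \<Rightarrow> real \<Rightarrow> (nat \<Rightarrow> real) \<Rightarrow> nat \<Rightarrow> real"
  where "stereo d \<sigma> x = (\<lambda>i. if i < d then x i / (1 - \<sigma> * x d) else 0)"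

definition stereo_inv :: "nat \<Rightarrow> real \<Rightarrow> (nat \<Rightarrow> real) \<Rightarrow> nat \<Rightarrow> real"
  where "stereo_inv d \<sigma> y = (\<lambda>i. if i < d then 2 * y i / (1 + norm_sq d y)
    else if i = d then \<sigma> * (norm_sq d y - 1) / (1 + norm_sq d y) else 0)"

definition punctured_sphere :: "nat \<Rightarrow> real \<Rightarrow> (nat \<Rightarrow> real) set"
  where "punctured_sphere d \<sigma> = {x \<in> topspace (nsphere d). x d \<noteq> \<sigma>}"

definition stereo_atlas :: "nat \<Rightarrow> (nat \<Rightarrow> real) chart set"
  where "stereo_atlas d = (\<lambda>\<sigma>. (punctured_sphere d \<sigma>, stereo d \<sigma>)) ` {1, - 1}"

lemma one_plus_norm_sq_pos [simp]: "1 + norm_sq d y > 0" "1 + norm_sq d y \<noteq> 0"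
  using norm_sq_nonneg[of d y] by linarith+

lemma square_sign: "\<sigma> \<in> {1, - 1} \<Longrightarrow> \<sigma> * \<sigma> = (1::real) \<and> \<sigma>\<^sup>2 = 1"
  by auto

lemma stereo_inv_in_sphere:
  assumes "\<sigma> \<in> {1, - 1}"
  shows "stereo_inv d \<sigma> y \<in> punctured_sphere d \<sigma>"
proof -
  let ?n = "norm_sq d y"
  have "norm_sq d (stereo_inv d \<sigma> y) = norm_sq d (\<lambda>i. 2 * (y i / (1 + ?n)))"
    by (rule norm_sq_cong) (simp add: stereo_inv_def)
  also have "\<dots> = 4 * ?n / (1 + ?n)\<^sup>2"
    unfolding norm_sq_cmult norm_sq_divide by simp
  finally have "norm_sq (Suc d) (stereo_inv d \<sigma> y) = 4 * ?n / (1 + ?n)\<^sup>2 + (?n - 1)\<^sup>2 / (1 + ?n)\<^sup>2"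
    using square_sign[OF assms] by (simp add: norm_sq_Suc stereo_inv_def power_divide power_mult_distrib)
  also have "\<dots> = 1"
    by (simp add: add_divide_distrib[symmetric]) (simp add: power2_eq_square algebra_simps)
  finally have 1: "norm_sq (Suc d) (stereo_inv d \<sigma> y) = 1" .
  have "stereo_inv d \<sigma> y d \<noteq> \<sigma>"
  proof
    assume "stereo_inv d \<sigma> y d = \<sigma>"
    then have "\<sigma> * (?n - 1) = \<sigma> * (1 + ?n)"
      by (simp add: stereo_inv_def divide_eq_eq)
    then show False using assms by auto
  qed
  with 1 show ?thesis
    by (auto simp: punctured_sphere_def topspace_nsphere) (simp add: stereo_inv_def)
qed

lemma stereo_denominator:
  assumes "\<sigma> \<in> {1, - 1}" "x \<in> punctured_sphere d \<sigma>"
  shows "1 - \<sigma> * x d \<noteq> 0"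
  using assms by (auto simp: punctured_sphere_def)

text \<open>
With \<open>u = \<sigma> x\<^sub>d\<close>, the remaining coordinates of \<open>x\<close> have square norm \<open>1 - u\<^sup>2 = (1 - u) (1 + u)\<close>.
\<close>

lemma norm_sq_stereo:
  assumes "\<sigma> \<in> {1, - 1}" "x \<in> punctured_sphere d \<sigma>"
  shows "norm_sq d (stereo d \<sigma> x) = (1 + \<sigma> * x d) / (1 - \<sigma> * x d)"
proof -
  let ?u = "\<sigma> * x d"
  have "norm_sq d x = 1 - ?u\<^sup>2"
    using assms square_sign[OF assms(1)]
    by (auto simp: punctured_sphere_def topspace_nsphere norm_sq_Suc power_mult_distrib)
  moreover have "norm_sq d (stereo d \<sigma> x) = norm_sq d (\<lambda>i. x i / (1 - ?u))"
    by (rule norm_sq_cong) (simp add: stereo_def)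
  ultimately have "norm_sq d (stereo d \<sigma> x) = (1 - ?u\<^sup>2) / (1 - ?u)\<^sup>2"
    by (simp add: norm_sq_divide)
  also have "\<dots> = (1 + ?u) / (1 - ?u)"
  proof -
    have "1 - ?u\<^sup>2 = (1 + ?u) * (1 - ?u)" by (simp add: power2_eq_square algebra_simps)
    then show ?thesis using stereo_denominator[OF assms] by (simp add: power2_eq_square)
  qed
  finally show ?thesis .
qed

lemma stereo_inv_stereo:
  assumes "\<sigma> \<in> {1, - 1}" "x \<in> punctured_sphere d \<sigma>"
  shows "stereo_inv d \<sigma> (stereo d \<sigma> x) = x"
proof
  fix i
  let ?u = "\<sigma> * x d"
  have nz: "1 - ?u \<noteq> 0" by (rule stereo_denominator[OF assms])
  have 1: "1 + norm_sq d (stereo d \<sigma> x) = 2 / (1 - ?u)"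
    using nz by (simp add: norm_sq_stereo[OF assms] field_simps)
  have 2: "norm_sq d (stereo d \<sigma> x) - 1 = 2 * ?u / (1 - ?u)"
    using nz by (simp add: norm_sq_stereo[OF assms] field_simps)
  have 3: "\<sigma> * ?u = x d" using square_sign[OF assms(1)] by (simp add: mult.assoc[symmetric])
  consider "i < d" | "i = d" | "i > d" by linarith
  then show "stereo_inv d \<sigma> (stereo d \<sigma> x) i = x i"
  proof cases
    case 1
    then show ?thesis using nz unfolding stereo_inv_def \<open>1 + _ = _\<close> by (simp add: stereo_def)
  next
    case 2
    then show ?thesis using nz 3 unfolding stereo_inv_def \<open>1 + _ = _\<close> \<open>norm_sq _ _ - 1 = _\<close>
      by simp
  next
    case 3
    then show ?thesis using assms(2) by (simp add: stereo_inv_def punctured_sphere_def topspace_nsphere)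
  qed
qed

lemma stereo_stereo_inv:
  assumes "\<sigma> \<in> {1, - 1}" "\<And>i. i \<ge> d \<Longrightarrow> y i = 0"
  shows "stereo d \<sigma> (stereo_inv d \<sigma> y) = y"
proof
  fix i
  let ?n = "norm_sq d y"
  have "\<sigma> * (\<sigma> * (?n - 1)) = ?n - 1"
    using square_sign[OF assms(1)] by (simp add: mult.assoc[symmetric])
  then have "1 - \<sigma> * stereo_inv d \<sigma> y d = 2 / (1 + ?n)"
    by (simp add: stereo_inv_def field_simps)
  then show "stereo d \<sigma> (stereo_inv d \<sigma> y) i = y i"
    using assms(2)[of i] by (auto simp: stereo_def stereo_inv_def)
qed

lemma stereo_image:
  assumes "\<sigma> \<in> {1, - 1}"
  shows "stereo d \<sigma> ` punctured_sphere d \<sigma> = topspace (Euclidean_space d)"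
proof
  show "stereo d \<sigma> ` punctured_sphere d \<sigma> \<subseteq> topspace (Euclidean_space d)"
    by (auto simp: topspace_Euclidean_space stereo_def)
  show "topspace (Euclidean_space d) \<subseteq> stereo d \<sigma> ` punctured_sphere d \<sigma>"
  proof
    fix y assume "y \<in> topspace (Euclidean_space d)"
    then have "y = stereo d \<sigma> (stereo_inv d \<sigma> y)"
      using stereo_stereo_inv[OF assms, of d y] by (simp add: topspace_Euclidean_space)
    then show "y \<in> stereo d \<sigma> ` punctured_sphere d \<sigma>"
      using stereo_inv_in_sphere[OF assms] by (rule image_eqI)
  qed
qed

lemma inv_into_stereo:
  assumes "\<sigma> \<in> {1, - 1}" "y \<in> topspace (Euclidean_space d)"
  shows "inv_into (punctured_sphere d \<sigma>) (stereo d \<sigma>) y = stereo_inv d \<sigma> y"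
proof -
  have "inj_on (stereo d \<sigma>) (punctured_sphere d \<sigma>)"
    by (rule inj_on_inverseI) (rule stereo_inv_stereo[OF assms(1)])
  then show ?thesis
    using stereo_inv_in_sphere[OF assms(1)] stereo_stereo_inv[OF assms(1)] assms(2)
    by (intro inv_into_f_eq) (auto simp: topspace_Euclidean_space)
qed

lemma stereo_inv_rational:
  assumes "V \<subseteq> topspace (Euclidean_space d)"
  shows "(\<lambda>y. stereo_inv d \<sigma> y i) \<in> rational_functions V"
proof -
  have n: "norm_sq d \<in> rational_functions V"
    unfolding norm_sq_def[abs_def] by (intro rational_functions_intros)
  consider "i < d" | "i = d" | "i > d" by linarith
  then show ?thesis
  proof cases
    case 1
    then show ?thesis unfolding stereo_inv_def by (auto intro!: rational_functions_divide n 
      intro: rational_functions.mult rational_functions.const rational_functions.coord rational_functions.add)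
  next
    case 2
    have "(\<lambda>y. \<sigma> * (norm_sq d y - 1) / (1 + norm_sq d y)) \<in> rational_functions V"
      by (rule rational_functions_divide[OF rational_functions.mult[OF rational_functions.const
         rational_functions_diff[OF n rational_functions.const]]
         rational_functions.add[OF rational_functions.const n]]) simp
    then show ?thesis using 2 by (simp add: stereo_inv_def)
  next
    case 3
    then show ?thesis by (simp add: stereo_inv_def rational_functions.const)
  qed
qed

lemma is_chart_stereo:
  assumes \<sigma>: "\<sigma> \<in> {1, - 1}"
  shows "is_chart d (nsphere d) (punctured_sphere d \<sigma>, stereo d \<sigma>)"
proof -
  let ?U = "punctured_sphere d \<sigma>" and ?E = "topspace (Euclidean_space d)"
  have "openin (nsphere d) ?U"
  proof -
    have "open {x :: nat \<Rightarrow> real. x d \<noteq> \<sigma>}"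
      by (intro open_Collect_neq continuous_intros continuous_on_product_coordinates)
    then show ?thesis
      unfolding punctured_sphere_def nsphere_eq_top_of_set
      by (auto simp: openin_open intro!: exI[of _ "{x. x d \<noteq> \<sigma>}"])
  qed
  moreover have "openin (Euclidean_space d) (stereo d \<sigma> ` ?U)"
    by (simp add: stereo_image[OF \<sigma>])
  moreover have "homeomorphic_map (subtopology (nsphere d) ?U)
      (subtopology (Euclidean_space d) (stereo d \<sigma> ` ?U)) (stereo d \<sigma>)"
  proof -
    have sub: "subtopology (nsphere d) ?U = top_of_set ?U"
    proof -
      have "topspace (nsphere d) \<inter> ?U = ?U" by (auto simp: punctured_sphere_def)
      then show ?thesis
        by (simp only: nsphere_eq_top_of_set subtopology_subtopology topspace_euclidean_subtopology)
    qed
    have E: "subtopology (Euclidean_space d) (stereo d \<sigma> ` ?U) = top_of_set ?E"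
      by (simp add: stereo_image[OF \<sigma>]) (simp add: Euclidean_space_eq_top_of_set)
    have "continuous_on ?U (stereo d \<sigma>)"
    proof (rule continuous_on_coordinatewise_then_product)
      show "continuous_on ?U (\<lambda>x. stereo d \<sigma> x i)" for i
        using stereo_denominator[OF \<sigma>] unfolding stereo_def
        by (cases "i < d") (auto intro!: continuous_intros
          continuous_on_product_coordinates[THEN continuous_on_subset])
    qed
    moreover have "continuous_on ?E (stereo_inv d \<sigma>)"
      by (rule continuous_on_coordinatewise_then_product)
        (rule continuous_on_rational_function[OF stereo_inv_rational[OF order_refl]])
    ultimately have "homeomorphic_maps (top_of_set ?U) (top_of_set ?E) (stereo d \<sigma>) (stereo_inv d \<sigma>)"
      using stereo_image[OF \<sigma>] stereo_inv_in_sphere[OF \<sigma>] stereo_inv_stereo[OF \<sigma>] stereo_stereo_inv[OF \<sigma>]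
      unfolding homeomorphic_maps_def continuous_map_iff_continuous2 topspace_euclidean_subtopology
      by (auto simp: topspace_Euclidean_space)
    then show ?thesis unfolding sub E by (auto simp: homeomorphic_map_maps)
  qed
  ultimately show ?thesis by (simp add: is_chart_def)
qed

text \<open>
The two charts have all of \<open>\<real>\<^sup>d\<close> as their image, so a function on the sphere is smooth as soon as
substituting the inverse projections gives rational functions without poles.
\<close>

lemma smooth_function_stereo_atlas:
  assumes "\<And>\<sigma>. \<sigma> \<in> {1, - 1} \<Longrightarrow>
    (\<lambda>y. f (stereo_inv d \<sigma> y)) \<in> rational_functions (topspace (Euclidean_space d))"
  shows "smooth_function d (stereo_atlas d) f"
  unfolding smooth_function_def stereo_atlas_def
proof clarify
  fix U \<phi> \<sigma> assume \<sigma>: "\<sigma> \<in> {1, - 1 :: real}"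
  show "smooth_on_Euclidean d (stereo d \<sigma> ` punctured_sphere d \<sigma>)
          (f \<circ> inv_into (punctured_sphere d \<sigma>) (stereo d \<sigma>))"
    unfolding stereo_image[OF \<sigma>]
    by (rule smooth_rational_function[OF _ assms[OF \<sigma>]]) (auto simp: inv_into_stereo[OF \<sigma>])
qed

lemma smooth_manifold_nsphere: "smooth_manifold d (nsphere d) (stereo_atlas d)"
proof -
  have cover: "topspace (nsphere d) = (\<Union>(U, \<phi>)\<in>stereo_atlas d. U)"
    by (auto simp: stereo_atlas_def punctured_sphere_def)
  have trans: "smooth_on_Euclidean d (stereo d \<sigma> ` (punctured_sphere d \<sigma> \<inter> punctured_sphere d \<tau>))
      (\<lambda>y. stereo d \<tau> (inv_into (punctured_sphere d \<sigma>) (stereo d \<sigma>) y) k)"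
    if \<sigma>: "\<sigma> \<in> {1, - 1}" and \<tau>: "\<tau> \<in> {1, - 1}" and k: "k < d" for \<sigma> \<tau> k
  proof -
    let ?V = "stereo d \<sigma> ` (punctured_sphere d \<sigma> \<inter> punctured_sphere d \<tau>)"
    have V: "?V \<subseteq> topspace (Euclidean_space d)" using stereo_image[OF \<sigma>] by blast
    have Vinv: "stereo_inv d \<sigma> y \<in> punctured_sphere d \<tau>" if "y \<in> ?V" for y
      using that stereo_inv_stereo[OF \<sigma>] by auto
    have "openin (Euclidean_space d) ?V"
    proof -
      have "homeomorphic_map (subtopology (nsphere d) (punctured_sphere d \<sigma>)) (Euclidean_space d) (stereo d \<sigma>)"
        using is_chart_stereo[OF \<sigma>] by (simp add: is_chart_def stereo_image[OF \<sigma>])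
      moreover have "openin (subtopology (nsphere d) (punctured_sphere d \<sigma>))
          (punctured_sphere d \<sigma> \<inter> punctured_sphere d \<tau>)"
        using is_chart_stereo[OF \<tau>] by (simp add: is_chart_def openin_subtopology_Int2)
      ultimately show ?thesis
        using homeomorphic_map_openness_eq by blast
    qed
    moreover have "(\<lambda>y. stereo_inv d \<sigma> y k / (1 - \<tau> * stereo_inv d \<sigma> y d)) \<in> rational_functions ?V"
      by (rule rational_functions_divide[OF stereo_inv_rational[OF V]
            rational_functions_diff[OF rational_functions.const
            rational_functions.mult[OF rational_functions.const stereo_inv_rational[OF V]]]])
        (use stereo_denominator[OF \<tau> Vinv] in auto)
    ultimately show ?thesis
      by (rule smooth_rational_function) (use V k in \<open>auto simp: inv_into_stereo[OF \<sigma>] subset_iff stereo_def\<close>)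
  qed
  have "smooth_atlas d (nsphere d) (stereo_atlas d)"
    unfolding smooth_atlas_def
  proof (intro conjI ballI cover)
    show "is_chart d (nsphere d) c" if "c \<in> stereo_atlas d" for c
      using that is_chart_stereo by (auto simp: stereo_atlas_def)
    show "case c of (U, \<phi>) \<Rightarrow> \<forall>(V, \<psi>)\<in>stereo_atlas d. \<forall>k<d.
        smooth_on_Euclidean d (\<phi> ` (U \<inter> V)) (\<lambda>y. \<psi> (inv_into U \<phi> y) k)"
      if "c \<in> stereo_atlas d" for c
    proof -
      from that obtain \<sigma> where \<sigma>: "c = (punctured_sphere d \<sigma>, stereo d \<sigma>)" "\<sigma> \<in> {1, - 1}"
        unfolding stereo_atlas_def by (rule imageE)
      show ?thesis
        unfolding \<sigma>(1) stereo_atlas_def prod.case ball_simps(9) using trans[OF \<sigma>(2)] by blast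
    qed
  qed
  then show ?thesis
    by (simp add: smooth_manifold_def Hausdorff_space_nsphere second_countable_nsphere)
qed


section \<open>Manifolds with corners cut out of a sphere by half-spaces\<close>

definition dot :: "nat \<Rightarrow> (nat \<Rightarrow> real) \<Rightarrow> (nat \<Rightarrow> real) \<Rightarrow> real"
  where "dot D a x = (\<Sum>i<D. a i * x i)"

lemma dot_cong: "(\<And>i. i < D \<Longrightarrow> x i = y i) \<Longrightarrow> dot D a x = dot D a y"
  by (simp add: dot_def)

lemma dot_upd:
  "dot D a (x(i := s)) = dot D a x + (if i < D then a i * (s - x i) else 0)"
proof -
  have "dot D a (x(i := s)) - dot D a x = (\<Sum>k<D. if k = i then a i * (s - x i) else 0)"
    unfolding dot_def sum_subtractf[symmetric] by (rule sum.cong) (auto simp: algebra_simps)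
  then show ?thesis by simp
qed

lemma norm_sq_upd: "i < d \<Longrightarrow> norm_sq d (x(i := s)) = norm_sq d x + (s\<^sup>2 - (x i)\<^sup>2)"
proof -
  assume "i < d"
  have "norm_sq d (x(i := s)) - norm_sq d x = (\<Sum>k<d. if k = i then s\<^sup>2 - (x i)\<^sup>2 else 0)"
    unfolding norm_sq_def sum_subtractf[symmetric] by (rule sum.cong) auto
  then show ?thesis using \<open>i < d\<close> by simp
qed

text \<open>
Only coordinates below \<open>D\<close> enter the scalar product, hence not the axis \<open>Suc D\<close> of the projection, and the
function to be differentiated is \<open>t - 2 \<langle>a, y\<rangle> / (1 + |y|\<^sup>2)\<close> for both poles.
\<close>

lemma partial_deriv_dot_stereo_inv:
  assumes "i < Suc D"
  shows "((\<lambda>s. t - dot D a (stereo_inv (Suc D) \<sigma> (y(i := s)))) has_real_derivative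
    - (2 * (if i < D then a i else 0) * (1 + norm_sq (Suc D) y) - 4 * dot D a y * y i)
       / (1 + norm_sq (Suc D) y)\<^sup>2) (at (y i))"
proof -
  let ?N = "norm_sq (Suc D) y" and ?b = "if i < D then a i else 0"
  have "dot D a (stereo_inv (Suc D) \<sigma> z) = 2 * dot D a z / (1 + norm_sq (Suc D) z)" for z
    by (simp add: dot_def stereo_inv_def sum_distrib_left sum_divide_distrib mult_ac)
  then have "(\<lambda>s. t - dot D a (stereo_inv (Suc D) \<sigma> (y(i := s)))) =
      (\<lambda>s. t - 2 * (dot D a y + ?b * (s - y i)) / (1 + (?N + (s\<^sup>2 - (y i)\<^sup>2))))"
    using assms by (simp add: norm_sq_upd dot_upd)
  moreover have "((\<lambda>s. t - 2 * (dot D a y + ?b * (s - y i)) / (1 + (?N + (s\<^sup>2 - (y i)\<^sup>2)))) has_real_derivative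
      - (2 * ?b * (1 + ?N) - 4 * dot D a y * y i) / (1 + ?N)\<^sup>2) (at (y i))"
    by (auto intro!: derivative_eq_intros simp: power2_eq_square[of "1 + ?N"])
       (simp add: algebra_simps diff_divide_distrib add_divide_distrib)
  ultimately show ?thesis by simp
qed

text \<open>
The sphere has coordinates \<open>0, \<dots>, Suc D\<close>; the half-spaces \<open>\<langle>a\<^sub>j, x\<rangle> \<le> t\<close> constrain the first \<open>D\<close> of
them, and \<open>\<K>\<close> is the intended nerve. The point \<open>p\<close> in \<open>inner_point\<close> lies in the open unit ball.
It serves twice: the circle over \<open>p\<close> shows that the face is non-empty, and \<open>|p| < 1\<close>
forces the face to be transversal to the sphere.
\<close>

locale spherical_corners =
  fixes D n :: nat and t :: real and a :: "nat \<Rightarrow> nat \<Rightarrow> real" and \<K> :: "nat set set"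
  assumes empty_face: "{} \<in> \<K>"
    and singleton_face: "\<And>j. j \<in> {1..n} \<Longrightarrow> {j} \<in> \<K>"
    and inner_point: "\<And>J. J \<subseteq> {1..n} \<Longrightarrow> J \<in> \<K> \<Longrightarrow> \<exists>p. norm_sq D p < 1 \<and>
      (\<forall>j\<in>J. dot D (a j) p = t) \<and> (\<forall>j\<in>{1..n}. dot D (a j) p \<le> t)"
    and nonface: "\<And>J x. J \<subseteq> {1..n} \<Longrightarrow> J \<notin> \<K> \<Longrightarrow> (\<And>j. j \<in> J \<Longrightarrow> dot D (a j) x = t) \<Longrightarrow> norm_sq D x > 1"
    and independent: "\<And>J c j. J \<subseteq> {1..n} \<Longrightarrow> J \<in> \<K> \<Longrightarrow> (\<And>i. i < D \<Longrightarrow> (\<Sum>j\<in>J. c j * a j i) = 0) \<Longrightarrow>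
      j \<in> J \<Longrightarrow> c j = 0"
begin

definition corners :: "(nat \<Rightarrow> real) corner_data"
  where "corners = \<lparr>ambient = nsphere (Suc D), dimension = Suc D, atlas = stereo_atlas (Suc D),
    num = n, rho = (\<lambda>j x. t - dot D (a j) x)\<rparr>"

lemma corners_simps [simp]:
  "ambient corners = nsphere (Suc D)" "dimension corners = Suc D" "atlas corners = stereo_atlas (Suc D)"
  "num corners = n" "rho corners j x = t - dot D (a j) x"
  by (simp_all add: corners_def)

lemma corner_space_corners:
  "corner_space corners = {x \<in> topspace (nsphere (Suc D)). \<forall>j\<in>{1..n}. dot D (a j) x \<le> t}"
  by (simp add: corner_space_def)

lemma face_corners:
  "face corners J = {x \<in> topspace (nsphere (Suc D)).
     (\<forall>j\<in>{1..n}. dot D (a j) x \<le> t) \<and> (\<forall>j\<in>J. dot D (a j) x = t)}"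
  by (auto simp: face_def hyperface_def corner_space_corners)

lemma norm_sq_le_1: "x \<in> topspace (nsphere (Suc D)) \<Longrightarrow> norm_sq D x \<le> 1"
  by (simp add: topspace_nsphere norm_sq_Suc[of "Suc D"] norm_sq_Suc[of D])
    (smt (verit) zero_le_power2)

lemma face_nonempty_iff:
  assumes "J \<subseteq> {1..n}"
  shows "face corners J \<noteq> {} \<longleftrightarrow> J \<in> \<K>"
proof
  assume "face corners J \<noteq> {}"
  then obtain x where x: "x \<in> topspace (nsphere (Suc D))" "\<And>j. j \<in> J \<Longrightarrow> dot D (a j) x = t"
    by (auto simp: face_corners)
  show "J \<in> \<K>"
  proof (rule ccontr)
    assume "J \<notin> \<K>"
    from nonface[OF assms this x(2)] norm_sq_le_1[OF x(1)] show False by simp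
  qed
next
  assume "J \<in> \<K>"
  then obtain p where p: "norm_sq D p < 1" "\<forall>j\<in>J. dot D (a j) p = t" "\<forall>j\<in>{1..n}. dot D (a j) p \<le> t"
    using inner_point[OF assms] by blast
  define x where "x = (\<lambda>i. if i < D then p i else if i = D then sqrt (1 - norm_sq D p) else 0)"
  have 1: "norm_sq D x = norm_sq D p" by (rule norm_sq_cong) (simp add: x_def)
  have 2: "dot D (a j) x = dot D (a j) p" for j by (rule dot_cong) (simp add: x_def)
  have "x \<in> topspace (nsphere (Suc D))"
    using p(1) by (simp add: topspace_nsphere norm_sq_Suc 1) (simp add: x_def)
  then have "x \<in> face corners J" using p by (simp add: face_corners 2)
  then show "face corners J \<noteq> {}" by blast
qed

text \<open>
Two points are joined by moving the first \<open>D\<close> coordinates along a segment, which stays in the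
convex set of constraints, while the angle in the plane of the last two coordinates is interpolated
linearly and the radius in that plane is determined by the equation of the sphere.
\<close>

lemma connected_face: "connected (face corners J)"
  unfolding connected_iff_connected_component
proof (intro ballI)
  fix x y assume x: "x \<in> face corners J" and y: "y \<in> face corners J"
  have angle: "\<exists>\<theta>. z D = sqrt (1 - norm_sq D z) * cos \<theta> \<and> z (Suc D) = sqrt (1 - norm_sq D z) * sin \<theta>"
    if "z \<in> face corners J" for z
  proof -
    define w where "w = Complex (z D) (z (Suc D))"
    have "cmod w = sqrt (1 - norm_sq D z)"
      using that by (auto simp: w_def cmod_def face_corners topspace_nsphere norm_sq_Suc intro!: arg_cong[of _ _ sqrt])
    moreover have "Re w = cmod w * cos (Arg w)" "Im w = cmod w * sin (Arg w)"
      by (metis rcis_cmod_Arg Re_rcis) (metis rcis_cmod_Arg Im_rcis)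
    ultimately show ?thesis by (auto simp: w_def)
  qed
  obtain \<theta> where \<theta>: "x D = sqrt (1 - norm_sq D x) * cos \<theta>" "x (Suc D) = sqrt (1 - norm_sq D x) * sin \<theta>"
    using angle[OF x] by blast
  obtain \<eta> where \<eta>: "y D = sqrt (1 - norm_sq D y) * cos \<eta>" "y (Suc D) = sqrt (1 - norm_sq D y) * sin \<eta>"
    using angle[OF y] by blast
  define seg where "seg s = (\<lambda>i. (1 - s) * x i + s * y i)" for s
  define path where "path s = (\<lambda>i. if i < D then seg s i
      else if i = D then sqrt (1 - norm_sq D (seg s)) * cos ((1 - s) * \<theta> + s * \<eta>)
      else if i = Suc D then sqrt (1 - norm_sq D (seg s)) * sin ((1 - s) * \<theta> + s * \<eta>) else 0)" for s
  have dot_seg: "dot D v (seg s) = (1 - s) * dot D v x + s * dot D v y" for v s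
    by (simp add: dot_def seg_def sum_distrib_left sum.distrib[symmetric] algebra_simps)
  have seg_le: "norm_sq D (seg s) \<le> 1" if "s \<in> {0..1}" for s
  proof -
    have "norm_sq D (seg s) \<le> (\<Sum>i<D. (1 - s) * (x i)\<^sup>2 + s * (y i)\<^sup>2)"
      unfolding norm_sq_def
    proof (rule sum_mono)
      fix i
      have "(1 - s) * (x i)\<^sup>2 + s * (y i)\<^sup>2 - (seg s i)\<^sup>2 = s * (1 - s) * (x i - y i)\<^sup>2"
        by (simp add: seg_def power2_eq_square algebra_simps)
      moreover have "0 \<le> s * (1 - s) * (x i - y i)\<^sup>2" using that by simp
      ultimately show "(seg s i)\<^sup>2 \<le> (1 - s) * (x i)\<^sup>2 + s * (y i)\<^sup>2" by linarith
    qed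
    also have "\<dots> = (1 - s) * norm_sq D x + s * norm_sq D y"
      by (simp add: norm_sq_def sum.distrib sum_distrib_left)
    also have "\<dots> \<le> (1 - s) * 1 + s * 1"
      using that x y norm_sq_le_1 by (intro add_mono mult_left_mono) (auto simp: face_corners)
    finally show ?thesis by simp
  qed
  have in_face: "path s \<in> face corners J" if s: "s \<in> {0..1}" for s
  proof -
    have "norm_sq D (path s) = norm_sq D (seg s)" by (rule norm_sq_cong) (simp add: path_def)
    then have "norm_sq (Suc (Suc D)) (path s) = norm_sq D (seg s)
        + (1 - norm_sq D (seg s)) * (cos ((1 - s) * \<theta> + s * \<eta>))\<^sup>2
        + (1 - norm_sq D (seg s)) * (sin ((1 - s) * \<theta> + s * \<eta>))\<^sup>2"
      using seg_le[OF s] by (simp add: norm_sq_Suc path_def power_mult_distrib)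
    also have "\<dots> = 1"
      by (simp only: add.assoc distrib_left[symmetric] sin_cos_squared_add2) simp
    finally have "path s \<in> topspace (nsphere (Suc D))"
      by (simp add: topspace_nsphere) (simp add: path_def)
    moreover have "dot D v (path s) = (1 - s) * dot D v x + s * dot D v y" for v
      using dot_cong[of D "path s" "seg s" v] by (simp add: path_def dot_seg)
    moreover have "(1 - s) * u + s * v \<le> t" if "u \<le> t" "v \<le> t" for u v
      using convex_bound_le[of u t v "1 - s" s] that s by simp
    moreover have "(1 - s) * t + s * t = t" by (simp add: algebra_simps)
    ultimately show ?thesis
      using x y by (auto simp: face_corners)
  qed
  have "continuous_on {0..1} path"
  proof (rule continuous_on_coordinatewise_then_product)
    have "continuous_on {0..1} (\<lambda>s. seg s i)" for i
      unfolding seg_def by (intro continuous_intros)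
    moreover have "continuous_on {0..1} (\<lambda>s. norm_sq D (seg s))"
      unfolding norm_sq_def by (intro continuous_intros calculation)
    ultimately show "continuous_on {0..1} (\<lambda>s. path s i)" for i
      unfolding path_def
      by (cases "i < D"; cases "i = D"; cases "i = Suc D") (auto intro!: continuous_intros)
  qed
  then have "connected (path ` {0..1})"
    by (rule connected_continuous_image) simp
  moreover have ends: "x = path 0" "y = path 1"
  proof -
    have out: "x i = 0" "y i = 0" if "i > Suc D" for i
      using x y that by (auto simp: face_corners topspace_nsphere)
    have seg01: "seg 0 = x" "seg 1 = y" by (auto simp: seg_def)
    show "x = path 0" "y = path 1"
      using \<theta> \<eta> out by (auto simp: path_def seg01 fun_eq_iff not_less_iff_gr_or_eq)
  qed
  ultimately show "connected_component (face corners J) x y"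
    unfolding connected_component_def using in_face by (intro exI[of _ "path ` {0..1}"]) auto
qed

lemma all_faces_connected_corners: "all_faces_connected corners"
proof -
  have "connectedin (nsphere (Suc D)) (face corners J)" for J
    using connected_face[of J]
    by (simp add: nsphere_eq_top_of_set connectedin_subtopology)
      (auto simp: face_corners topspace_nsphere)
  then show ?thesis by (simp add: all_faces_connected_def)
qed

text \<open>
Let \<open>w = \<Sum>\<^bsub>j\<in>J\<^esub> c\<^sub>j a\<^sub>j\<close> be a combination whose restriction to the tangent space at \<open>x\<close> vanishes.
Then \<open>w\<close> is a multiple \<open>W x\<close> of \<open>x\<close>. If \<open>W = 0\<close>, the independence of the \<open>a\<^sub>j\<close> applies. Otherwise
\<open>x\<close> is itself a combination of the \<open>a\<^sub>j\<close>, all of which have the same scalar products with \<open>x\<close>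
and with the inner point \<open>p\<close>; so \<open>1 = |x|\<^sup>2 = \<langle>x, p\<rangle> \<le> |x| |p| < 1\<close>, a contradiction.
\<close>

lemma independent_differentials_corners:
  assumes J: "J \<subseteq> {1..n}" and x: "x \<in> face corners J"
  shows "independent_differentials (Suc D) (stereo_atlas (Suc D)) (rho corners) J x"
  unfolding independent_differentials_def
proof (intro ballI impI allI)
  fix ch and c :: "nat \<Rightarrow> real" and k
  assume "ch \<in> stereo_atlas (Suc D)" "x \<in> fst ch"
    and *: "\<forall>i<Suc D. (\<Sum>j\<in>J. c j * differential_in_chart ch (rho corners j) x i) = 0"
    and k: "k \<in> J"
  then obtain \<sigma> where ch: "ch = (punctured_sphere (Suc D) \<sigma>, stereo (Suc D) \<sigma>)" and \<sigma>: "\<sigma> \<in> {1, - 1}"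
    and xU: "x \<in> punctured_sphere (Suc D) \<sigma>"
    unfolding stereo_atlas_def by (metis (no_types, lifting) fst_conv imageE)
  have JK: "J \<in> \<K>" using face_nonempty_iff[OF J] x by blast
  define y where "y = stereo (Suc D) \<sigma> x"
  define N where "N = norm_sq (Suc D) y"
  have N: "1 + N \<noteq> 0" by (simp add: N_def)
  have y_out: "y i = 0" if "i \<ge> Suc D" for i using that by (simp add: y_def stereo_def)
  have x_eq: "x = stereo_inv (Suc D) \<sigma> y" by (simp add: y_def stereo_inv_stereo[OF \<sigma> xU])
  have x_y: "x i = 2 * y i / (1 + N)" if "i < D" for i
    using that by (simp add: x_eq stereo_inv_def N_def)
  define w where "w i = (\<Sum>j\<in>J. c j * (if i < D then a j i else 0))" for i
  define W where "W = (\<Sum>j\<in>J. c j * dot D (a j) y)"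
  have diff: "differential_in_chart ch (rho corners j) x i =
      - (2 * (if i < D then a j i else 0) * (1 + N) - 4 * dot D (a j) y * y i) / (1 + N)\<^sup>2"
    if "i < Suc D" for i j
  proof -
    have "y(i := s) \<in> topspace (Euclidean_space (Suc D))" for s
      using y_out that by (auto simp: topspace_Euclidean_space)
    then have "differential_in_chart ch (rho corners j) x i =
        deriv (\<lambda>s. t - dot D (a j) (stereo_inv (Suc D) \<sigma> (y(i := s)))) (y i)"
      by (simp add: differential_in_chart_def ch partial_deriv_def inv_into_stereo[OF \<sigma>] flip: y_def)
    then show ?thesis
      using DERIV_imp_deriv[OF partial_deriv_dot_stereo_inv[OF that]] by (simp add: N_def)
  qed
  have w_y: "w i * (1 + N) = 2 * W * y i" if i: "i < Suc D" for i
  proof -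
    have "0 = (\<Sum>j\<in>J. c j * differential_in_chart ch (rho corners j) x i)"
      using * i by simp
    also have "\<dots> = (\<Sum>j\<in>J. c j * (- (2 * (if i < D then a j i else 0) * (1 + N)
        - 4 * dot D (a j) y * y i) / (1 + N)\<^sup>2))"
      by (simp only: diff[OF i])
    also have "\<dots> = (- 2 * w i * (1 + N) + 4 * W * y i) / (1 + N)\<^sup>2"
      by (simp add: w_def W_def sum_distrib_left sum_distrib_right sum_divide_distrib
          sum_subtractf[symmetric] sum.distrib[symmetric] sum_negf[symmetric] algebra_simps
          add_divide_distrib diff_divide_distrib)
    finally show ?thesis using N by simp
  qed
  show "c k = 0"
  proof (cases "W = 0")
    case True
    have "(\<Sum>j\<in>J. c j * a j i) = 0" if "i < D" for i
      using w_y[of i] True N that by (simp add: w_def)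
    then show ?thesis using independent[OF J JK] k by blast
  next
    case False
    \<comment> \<open>The coordinate \<open>D\<close> is constrained by no half-space, so \<open>w D = 0\<close>.\<close>
    have yD: "y D = 0" using w_y[of D] False by (simp add: w_def)
    have W_w: "W = (\<Sum>i<D. w i * y i)"
      by (simp add: W_def dot_def w_def sum_distrib_left sum_distrib_right mult_ac)
        (rule sum.swap)
    \<comment> \<open>Pairing the relations with \<open>y\<close> gives \<open>W (1 + N) = 2 W N\<close>: the point lies on the equator.\<close>
    have "W * (1 + N) = (\<Sum>i<D. (w i * (1 + N)) * y i)"
      unfolding W_w by (simp add: sum_distrib_left sum_distrib_right mult_ac)
    also have "\<dots> = 2 * W * norm_sq D y"
      using w_y by (simp add: norm_sq_def sum_distrib_left power2_eq_square mult_ac)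
    also have "norm_sq D y = N" by (simp add: N_def norm_sq_Suc yD)
    finally have N1: "N = 1" using False by (simp add: algebra_simps)
    have xy: "x i = y i" if "i < D" for i using x_y[OF that] by (simp add: N1)
    have wx: "w i = W * x i" if "i < D" for i using w_y[of i] that by (simp add: N1 xy)
    have nx: "norm_sq D x = 1"
      using norm_sq_cong[of D x y, OF xy] N1 by (simp add: N_def norm_sq_Suc yD)
    obtain p where p: "norm_sq D p < 1" "\<forall>j\<in>J. dot D (a j) p = t"
      using inner_point[OF J JK] by blast
    have "W * dot D x p = (\<Sum>i<D. w i * p i)"
      by (simp add: dot_def wx sum_distrib_left mult_ac)
    also have "\<dots> = (\<Sum>j\<in>J. c j * dot D (a j) p)"
      by (simp add: dot_def w_def sum_distrib_left sum_distrib_right mult_ac)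
        (rule sum.swap)
    also have "\<dots> = (\<Sum>j\<in>J. c j * dot D (a j) x)"
      using p(2) x by (auto simp: face_corners)
    also have "\<dots> = W"
      using dot_cong[of D x y, OF xy] by (simp add: W_def)
    finally have "dot D x p = 1" using False by simp
    moreover have "(dot D x p)\<^sup>2 \<le> norm_sq D x * norm_sq D p"
      unfolding dot_def norm_sq_def by (rule Cauchy_Schwarz_ineq_sum)
    ultimately show ?thesis using nx p(1) by simp
  qed
qed

lemma compact_manifold_with_embedded_corners_corners:
  "compact_manifold_with_embedded_corners corners"
proof -
  have "face corners {} \<noteq> {}" using face_nonempty_iff[of "{}"] empty_face by simp
  moreover have "face corners {j} = hyperface corners j" for j
    by (auto simp: face_def hyperface_def)
  then have "hyperface corners j \<noteq> {}" if "j \<in> {1..n}" for j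
    using face_nonempty_iff[of "{j}"] singleton_face[OF that] that by simp
  moreover have "smooth_function (Suc D) (stereo_atlas (Suc D)) (\<lambda>x. t - dot D (a j) x)" for j
    by (rule smooth_function_stereo_atlas)
      (unfold dot_def, intro rational_functions_diff rational_functions.const rational_functions_sum
        rational_functions.mult stereo_inv_rational order_refl)
  then have "smooth_function (Suc D) (stereo_atlas (Suc D)) (rho corners j)" for j
    by (simp add: corners_def)
  ultimately show ?thesis
    using independent_differentials_corners smooth_manifold_nsphere compact_space_nsphere
    by (simp add: compact_manifold_with_embedded_corners_def face_def)
qed

end


section \<open>Realizing the triangles of a graph as a nerve\<close>

lemma norm_sq_dot: "norm_sq D x = dot D x x"
  by (simp add: norm_sq_def dot_def power2_eq_square)

lemma dot_commute: "dot D x y = dot D y x"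
  by (simp add: dot_def mult.commute)

lemma dot_add_left: "dot D (\<lambda>i. x i + y i) z = dot D x z + dot D y z"
  by (simp add: dot_def distrib_right sum.distrib)

lemma dot_add_right: "dot D z (\<lambda>i. x i + y i) = dot D z x + dot D z y"
  by (simp add: dot_def distrib_left sum.distrib)

lemma dot_cmult_sum_right: "dot D z (\<lambda>i. c * (\<Sum>j\<in>J. b j i)) = c * (\<Sum>j\<in>J. dot D z (b j))"
  by (simp add: dot_def sum_distrib_left mult_ac) (rule sum.swap)

text \<open>
Every edge gets a coordinate of its own, in which exactly its two end points have the entry \<open>1\<close>.
\<close>

lemma exists_vectors_orthogonal_off_graph:
  assumes "finite E"
  shows "\<exists>D a. \<forall>i j. i < j \<longrightarrow> dot D (a i) (a j) = (if (i, j :: nat) \<in> E then 1 else 0)"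
  using assms
proof (induction E)
  case empty
  show ?case by (intro exI[of _ 0] exI) (simp add: dot_def)
next
  case (insert e E)
  then obtain D a where a: "\<And>i j. i < j \<Longrightarrow> dot D (a i) (a j) = (if (i, j) \<in> E then 1 else 0)" by blast
  obtain u v where e: "e = (u, v)" by (cases e)
  show ?case
  proof (cases "u < v")
    case True
    define b where "b j = (\<lambda>k. if k < D then a j k else if j = u \<or> j = v then 1 else 0)" for j
    have "dot (Suc D) (b i) (b j) = dot D (a i) (a j) + (if (i, j) = e then 1 else 0)" if "i < j" for i j
      using that True by (auto simp: dot_def b_def e)
    then show ?thesis
      using a insert.hyps(2) by (intro exI[of _ "Suc D"] exI[of _ b]) auto
  next
    case False
    then show ?thesis using a by (intro exI[of _ D] exI[of _ a]) (auto simp: e)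
  qed
qed

text \<open>
One further coordinate for each vertex brings all vectors to the common square length \<open>\<Delta>\<close> without
changing the other scalar products, and makes the vectors linearly independent.
\<close>

lemma exists_vectors_with_gram_matrix:
  fixes E :: "nat \<Rightarrow> nat \<Rightarrow> bool"
  assumes sym: "\<And>i j. E i j \<Longrightarrow> E j i"
  obtains D a \<Delta> where "\<Delta> \<ge> 4"
    "\<And>i j. i \<in> {1..n} \<Longrightarrow> j \<in> {1..n} \<Longrightarrow> dot D (a i) (a j) = (if i = j then \<Delta> else if E i j then 1 else 0)"
    "\<And>J c j. J \<subseteq> {1..n} \<Longrightarrow> (\<And>i. i < D \<Longrightarrow> (\<Sum>j\<in>J. c j * a j i) = 0) \<Longrightarrow> j \<in> J \<Longrightarrow> c j = 0"
proof -
  have "finite {(i, j). i \<le> n \<and> j \<le> n \<and> E i j}"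
    by (rule finite_subset[of _ "{..n} \<times> {..n}"]) auto
  then obtain C b where b0: "\<And>i j. i < j \<Longrightarrow>
      dot C (b i) (b j) = (if (i, j) \<in> {(i, j). i \<le> n \<and> j \<le> n \<and> E i j} then 1 else 0)"
    using exists_vectors_orthogonal_off_graph by blast
  have b: "dot C (b i) (b j) = (if E i j then 1 else 0)" if "i \<in> {1..n}" "j \<in> {1..n}" "i \<noteq> j" for i j
  proof (cases "i < j")
    case True
    then show ?thesis using b0 that by auto
  next
    case False
    then show ?thesis using b0[of j i] that sym by (auto simp: dot_commute[of C "b i"])
  qed
  define \<Delta> where "\<Delta> = 4 + (\<Sum>j\<in>{1..n}. norm_sq C (b j))"
  define \<mu> where "\<mu> j = sqrt (\<Delta> - norm_sq C (b j))" for j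
  define a where "a j = (\<lambda>k. if k < C then b j k else if k = C + j then \<mu> j else 0)" for j
  have lt: "norm_sq C (b j) < \<Delta>" if "j \<in> {1..n}" for j
  proof -
    have "norm_sq C (b j) \<le> (\<Sum>j\<in>{1..n}. norm_sq C (b j))"
      using that by (intro member_le_sum) auto
    then show ?thesis by (simp add: \<Delta>_def)
  qed
  show ?thesis
  proof (rule that[of \<Delta> "C + Suc n" a])
    show "4 \<le> \<Delta>" by (simp add: \<Delta>_def sum_nonneg)
    fix i j assume ij: "i \<in> {1..n}" "j \<in> {1..n}"
    have "dot (C + Suc n) (a i) (a j) = (\<Sum>k<C. a i k * a j k) + (\<Sum>k\<in>{C..<C + Suc n}. a i k * a j k)"
      unfolding dot_def lessThan_atLeast0 by (rule sum.atLeastLessThan_concat[symmetric]) auto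
    also have "(\<Sum>k<C. a i k * a j k) = dot C (b i) (b j)"
      by (simp add: dot_def a_def)
    also have "(\<Sum>k\<in>{C..<C + Suc n}. a i k * a j k) =
        (\<Sum>k\<in>{C..<C + Suc n}. if k = C + i then (if i = j then (\<mu> i)\<^sup>2 else 0) else 0)"
      by (rule sum.cong) (auto simp: a_def power2_eq_square)
    also have "\<dots> = (if i = j then (\<mu> i)\<^sup>2 else 0)"
      using ij by simp
    finally show "dot (C + Suc n) (a i) (a j) = (if i = j then \<Delta> else if E i j then 1 else 0)"
      using b[OF ij] lt[OF ij(1)] by (auto simp: \<mu>_def norm_sq_dot)
  next
    fix J c j assume J: "J \<subseteq> {1..n}" "\<And>i. i < C + Suc n \<Longrightarrow> (\<Sum>j\<in>J. c j * a j i) = 0" and j: "j \<in> J"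
    have "0 = (\<Sum>l\<in>J. c l * a l (C + j))" using J j by force
    also have "\<dots> = (\<Sum>l\<in>J. if l = j then c j * \<mu> j else 0)"
      by (rule sum.cong) (auto simp: a_def)
    also have "\<dots> = c j * \<mu> j"
      using j finite_subset[OF J(1)] by simp
    finally show "c j = 0"
      using lt[of j] j J(1) by (auto simp: \<mu>_def)
  qed
qed

definition clique :: "(nat \<Rightarrow> nat \<Rightarrow> bool) \<Rightarrow> nat set \<Rightarrow> bool"
  where "clique E J \<longleftrightarrow> (\<forall>i\<in>J. \<forall>j\<in>J. i \<noteq> j \<longrightarrow> E i j)"

text \<open>
The pairs that are no edges are included because the corresponding faces cannot be avoided: the
intersections of three hypersurfaces are removed by their larger distance from the origin, and
those of two hypersurfaces are always closer.
\<close>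

definition triangle_complex :: "(nat \<Rightarrow> nat \<Rightarrow> bool) \<Rightarrow> nat set set"
  where "triangle_complex E = {J. card J \<le> 2 \<or> card J = 3 \<and> clique E J}"

text \<open>
If all scalar products within \<open>J\<close> equal \<open>g\<close>, the nearest point to the origin with \<open>\<langle>a\<^sub>j, x\<rangle> = t\<close> on \<open>J\<close>
is a multiple of \<open>\<Sum>\<^bsub>j\<in>J\<^esub> a\<^sub>j\<close> and has square norm \<open>|J| t\<^sup>2 / (\<Delta> + (|J| - 1) g)\<close>. For a triangle this is
\<open>3 t\<^sup>2 / (\<Delta> + 2)\<close>. For a triple with a missing edge the Cauchy-Schwarz inequality bounds the square norm
from below by \<open>9 t\<^sup>2 / (3 \<Delta> + 4)\<close>. The choice of \<open>t\<close> separates the two values, \<open>9 t\<^sup>2\<close> being halfway between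
\<open>3 \<Delta> + 4\<close> and \<open>3 \<Delta> + 6\<close>. As there is no clique of four vertices, every larger set contains such a triple.
\<close>

lemma triangle_complex_spherical_corners:
  fixes E :: "nat \<Rightarrow> nat \<Rightarrow> bool"
  assumes sym: "\<And>i j. E i j \<Longrightarrow> E j i"
    and no_4_clique: "\<And>J. J \<subseteq> {1..n} \<Longrightarrow> card J = 4 \<Longrightarrow> \<not> clique E J"
  shows "\<exists>D t a. spherical_corners D n t a (triangle_complex E)"
proof (rule exists_vectors_with_gram_matrix[where E = E and n = n, OF sym])
  fix D a \<Delta>
  assume \<Delta>: "(\<Delta> :: real) \<ge> 4"
    and gram: "\<And>i j. i \<in> {1..n} \<Longrightarrow> j \<in> {1..n} \<Longrightarrow>
      dot D (a i) (a j) = (if i = j then \<Delta> else if E i j then 1 else 0)"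
    and indep: "\<And>J c j. J \<subseteq> {1..n} \<Longrightarrow> (\<And>i. i < D \<Longrightarrow> (\<Sum>j\<in>J. c j * a j i) = 0) \<Longrightarrow> j \<in> J \<Longrightarrow> c j = (0 :: real)"
  define t where "t = sqrt ((3 * \<Delta> + 5) / 9)"
  have t0: "t > 0" and t2: "9 * t\<^sup>2 = 3 * \<Delta> + 5" using \<Delta> by (simp_all add: t_def)
  have "spherical_corners D n t a (triangle_complex E)"
  proof
    show "{} \<in> triangle_complex E" "{j} \<in> triangle_complex E" for j
      by (simp_all add: triangle_complex_def)
  next
    fix J assume J: "J \<subseteq> {1..n}" "J \<in> triangle_complex E"
    have fin: "finite J" using J(1) by (rule finite_subset) simp
    have k3: "card J \<le> 3" using J(2) by (auto simp: triangle_complex_def)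
    obtain g where g: "g \<in> {0, 1}" "\<And>i j. i \<in> J \<Longrightarrow> j \<in> J \<Longrightarrow> i \<noteq> j \<Longrightarrow> dot D (a i) (a j) = g"
      "card J = 3 \<Longrightarrow> g = 1"
    proof (cases "card J = 3")
      case True
      then have "clique E J" using J(2) by (simp add: triangle_complex_def)
      then show ?thesis
        using J(1) by (intro that[of 1]) (auto simp: clique_def gram subset_iff)
    next
      case False
      show ?thesis
      proof (cases "card J = 2")
        case True
        then obtain u v where uv: "J = {u, v}" "u \<noteq> v" by (auto simp: card_2_iff)
        then have "dot D (a u) (a v) \<in> {0, 1}" using gram[of u v] J(1) by auto
        then show ?thesis
          using uv False by (intro that[of "dot D (a u) (a v)"]) (auto simp: dot_commute)
      next
        case False
        then have "card J \<le> Suc 0" using k3 \<open>card J \<noteq> 3\<close> by simp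
        then have "i = j" if "i \<in> J" "j \<in> J" for i j
          using card_le_Suc0_iff_eq[OF fin] that by blast
        then show ?thesis using \<open>card J \<noteq> 3\<close> by (intro that[of 0]) auto
      qed
    qed
    let ?k = "real (card J)"
    define m where "m = (if J = {} then \<Delta> else \<Delta> + (?k - 1) * g)"
    have k1: "?k \<ge> 1" if "J \<noteq> {}"
    proof -
      have "card J > 0" using that fin by (simp add: card_gt_0_iff)
      then show ?thesis by simp
    qed
    have m\<Delta>: "\<Delta> \<le> m"
    proof (cases "J = {}")
      case False
      have "0 \<le> (?k - 1) * g" using k1[OF False] g(1) by (intro mult_nonneg_nonneg) auto
      then show ?thesis using False by (simp add: m_def)
    qed (simp add: m_def)
    define p where "p = (\<lambda>i. t / m * (\<Sum>j\<in>J. a j i))"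
    have dot_p: "dot D z p = t / m * (\<Sum>j\<in>J. dot D z (a j))" for z
      unfolding p_def by (rule dot_cmult_sum_right)
    have dot_in: "dot D (a i) p = t" if i: "i \<in> J" for i
    proof -
      have "(\<Sum>j\<in>J. dot D (a i) (a j)) = dot D (a i) (a i) + (\<Sum>j\<in>J - {i}. dot D (a i) (a j))"
        using fin i by (rule sum.remove)
      also have "(\<Sum>j\<in>J - {i}. dot D (a i) (a j)) = (\<Sum>j\<in>J - {i}. g)"
        using i g(2) by (intro sum.cong) auto
      also have "dot D (a i) (a i) + \<dots> = m"
      proof -
        have "real (card (J - {i})) = ?k - 1"
          using card_Suc_Diff1[OF fin i] by linarith
        moreover have "J \<noteq> {}" "dot D (a i) (a i) = \<Delta>" using i J(1) by (auto simp: gram)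
        ultimately show ?thesis by (simp add: m_def)
      qed
      finally show ?thesis using m\<Delta> \<Delta> by (simp add: dot_p)
    qed
    have dot_out: "dot D (a i) p \<le> t" if i: "i \<in> {1..n}" "i \<notin> J" for i
    proof -
      have "(\<Sum>j\<in>J. dot D (a i) (a j)) \<le> (\<Sum>j\<in>J. 1)"
      proof (rule sum_mono)
        fix j assume "j \<in> J"
        then have "j \<noteq> i" "j \<in> {1..n}" using i J(1) by auto
        then show "dot D (a i) (a j) \<le> 1" using gram[OF i(1)] by simp
      qed
      also have "\<dots> \<le> m" using k3 m\<Delta> \<Delta> by simp
      finally have "t / m * (\<Sum>j\<in>J. dot D (a i) (a j)) \<le> t / m * m"
        using t0 m\<Delta> \<Delta> by (intro mult_left_mono) auto
      then show ?thesis using m\<Delta> \<Delta> by (simp add: dot_p)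
    qed
    have "norm_sq D p = t / m * (\<Sum>j\<in>J. dot D (a j) p)"
      by (simp add: norm_sq_dot dot_p[of p] dot_commute)
    also have "\<dots> = ?k * t\<^sup>2 / m" by (simp add: dot_in power2_eq_square)
    finally have np: "norm_sq D p = ?k * t\<^sup>2 / m" .
    have "9 * (?k * t\<^sup>2) < 9 * m"
    proof (cases "card J = 3")
      case True
      then have "m = \<Delta> + 2" using g(3) by (auto simp: m_def)
      then show ?thesis using True t2 by simp
    next
      case False
      then have "?k * (9 * t\<^sup>2) \<le> 2 * (9 * t\<^sup>2)" using k3 by (intro mult_right_mono) auto
      also have "\<dots> < 9 * \<Delta>" using t2 \<Delta> by simp
      finally show ?thesis using m\<Delta> by simp
    qed
    then have "norm_sq D p < 1" using m\<Delta> \<Delta> by (simp add: np)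
    then show "\<exists>p. norm_sq D p < 1 \<and> (\<forall>j\<in>J. dot D (a j) p = t) \<and> (\<forall>j\<in>{1..n}. dot D (a j) p \<le> t)"
    proof (intro exI[of _ p] conjI ballI dot_in)
      show "dot D (a j) p \<le> t" if "j \<in> {1..n}" for j
        using dot_in[of j] dot_out[of j] that by (cases "j \<in> J") auto
    qed
  next
    fix J x assume J: "J \<subseteq> {1..n}" "J \<notin> triangle_complex E" and x: "\<And>j. j \<in> J \<Longrightarrow> dot D (a j) x = t"
    have fin: "finite J" using J(1) by (rule finite_subset) simp
    have "\<not> clique E J" and card3: "card J \<ge> 3"
    proof -
      show "card J \<ge> 3" using J(2) by (auto simp: triangle_complex_def)
      show "\<not> clique E J"
      proof (cases "card J = 3")
        case True
        then show ?thesis using J(2) by (simp add: triangle_complex_def)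
      next
        case False
        then have "4 \<le> card J" using \<open>card J \<ge> 3\<close> by simp
        then obtain T where T: "T \<subseteq> J" "card T = 4" using obtain_subset_with_card_n by metis
        then have "\<not> clique E T" using no_4_clique J(1) by blast
        then show ?thesis using T(1) by (auto simp: clique_def)
      qed
    qed
    then obtain i j where ij: "i \<in> J" "j \<in> J" "i \<noteq> j" "\<not> E i j" by (auto simp: clique_def)
    have "card {i, j} < card J" using ij card3 by simp
    then obtain l where l: "l \<in> J" "l \<noteq> i" "l \<noteq> j"
      using card_mono[of "{i, j}" J] by (auto simp: subset_iff)
    define s where "s = (\<lambda>k. a i k + (a j k + a l k))"
    have "dot D s x = 3 * t" using x ij l by (simp add: s_def dot_add_left)
    moreover have "norm_sq D s \<le> 3 * \<Delta> + 4"
    proof -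
      have "norm_sq D s = dot D (a i) (a i) + dot D (a j) (a j) + dot D (a l) (a l)
          + 2 * dot D (a i) (a j) + 2 * dot D (a i) (a l) + 2 * dot D (a j) (a l)"
        by (simp add: norm_sq_dot s_def dot_add_left dot_add_right dot_commute)
      then show ?thesis using ij l J(1) by (auto simp: gram subset_iff)
    qed
    moreover have "(dot D s x)\<^sup>2 \<le> norm_sq D s * norm_sq D x"
      unfolding dot_def norm_sq_def by (rule Cauchy_Schwarz_ineq_sum)
    ultimately have "9 * t\<^sup>2 \<le> (3 * \<Delta> + 4) * norm_sq D x"
      using mult_right_mono[of "norm_sq D s" "3 * \<Delta> + 4" "norm_sq D x"]
      by (simp add: power_mult_distrib)
    then have "(3 * \<Delta> + 4) * 1 < (3 * \<Delta> + 4) * norm_sq D x" using t2 by simp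
    then show "norm_sq D x > 1" using \<Delta> by simp
  next
    fix J c j assume "J \<subseteq> {1..n}" "\<And>i. i < D \<Longrightarrow> (\<Sum>j\<in>J. c j * a j i) = 0" "j \<in> J"
    then show "c j = 0" by (rule indep)
  qed
  then show ?thesis by blast
qed

lemma exists_corners_with_triangle_complex:
  fixes E :: "nat \<Rightarrow> nat \<Rightarrow> bool"
  assumes "\<And>i j. E i j \<Longrightarrow> E j i"
    and "\<And>J. J \<subseteq> {1..n} \<Longrightarrow> card J = 4 \<Longrightarrow> \<not> clique E J"
  obtains X :: "(nat \<Rightarrow> real) corner_data"
  where "compact_manifold_with_embedded_corners X" "all_faces_connected X" "num X = n"
    "\<And>J. J \<subseteq> {1..n} \<Longrightarrow> face X J \<noteq> {} \<longleftrightarrow> J \<in> triangle_complex E"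
proof -
  have "\<exists>D t a. spherical_corners D n t a (triangle_complex E)"
    using assms by (rule triangle_complex_spherical_corners)
  then obtain D t a where "spherical_corners D n t a (triangle_complex E)"
    by (elim exE)
  then interpret spherical_corners D n t a "triangle_complex E" .
  show ?thesis
    by (rule that[OF compact_manifold_with_embedded_corners_corners all_faces_connected_corners
          corners_simps(4) face_nonempty_iff])
qed


section \<open>The conormal complex\<close>

abbreviation face_chains :: "'a corner_data \<Rightarrow> nat \<Rightarrow> (oriented_face \<Rightarrow>\<^sub>0 int) monoid"
  where "face_chains X p \<equiv> free_Abelian_group (oriented_faces X p)"

abbreviation boundary :: "(oriented_face \<Rightarrow>\<^sub>0 int) \<Rightarrow> (oriented_face \<Rightarrow>\<^sub>0 int)"
  where "boundary \<equiv> frag_extend contraction"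

lemma face_antimono: "K \<subseteq> J \<Longrightarrow> face X J \<subseteq> face X K"
  by (auto simp: face_def)

lemma keys_contraction:
  assumes "(J, s) \<in> oriented_faces X p"
  shows "Poly_Mapping.keys (contraction (J, s)) \<subseteq> oriented_faces X (p - 1)"
proof -
  have J: "J \<subseteq> {1..num X}" "card J = p" "face X J \<noteq> {}" "s \<in> {1, - 1}"
    using assms by (auto simp: oriented_faces_def)
  have "(J - {j}, s) \<in> oriented_faces X (p - 1)" if "j \<in> J" for j
    using J that face_antimono[of "J - {j}" J X] finite_subset[OF J(1)]
    by (auto simp: oriented_faces_def)
  then show ?thesis
    unfolding contraction_def prod.case
    by (intro order_trans[OF keys_sum] UN_least) (auto simp: keys_frag_of)
qed

lemma keys_boundary:
  assumes "Poly_Mapping.keys c \<subseteq> oriented_faces X p"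
  shows "Poly_Mapping.keys (boundary c) \<subseteq> oriented_faces X (p - 1)"
proof -
  have "Poly_Mapping.keys (contraction x) \<subseteq> oriented_faces X (p - 1)" if "x \<in> Poly_Mapping.keys c" for x
    using keys_contraction[of "fst x" "snd x" X p] assms that by auto
  then show ?thesis
    using keys_frag_extend[of contraction c] by blast
qed

text \<open>
Omitting the smaller index first lowers the position of the larger one by one, while omitting the larger
index first leaves the position of the smaller one unchanged.
\<close>

lemma sign_contraction_swap:
  fixes j l :: nat
  assumes "finite J" "j \<in> J" "l \<in> J" "j < l"
  shows "(- 1 :: int) ^ card {m \<in> J. m < j} * (- 1) ^ card {m \<in> J - {j}. m < l}
    = - ((- 1) ^ card {m \<in> J. m < l} * (- 1) ^ card {m \<in> J - {l}. m < j})"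
proof -
  have 1: "{m \<in> J - {l}. m < j} = {m \<in> J. m < j}" using assms(4) by auto
  have "{m \<in> J. m < l} = insert j {m \<in> J - {j}. m < l}" using assms(2,4) by auto
  then have 2: "card {m \<in> J. m < l} = Suc (card {m \<in> J - {j}. m < l})"
    using assms(1) by simp
  show ?thesis unfolding 1 2 by simp
qed

text \<open>
The double sum runs over ordered pairs of distinct elements of \<open>J\<close> and changes its sign when the
pairs are swapped, so it equals its own negative; the chain group has no torsion.
\<close>

lemma boundary_contraction: "boundary (contraction (J, s)) = 0"
proof (cases "finite J")
  case False
  then show ?thesis by (simp add: contraction_def)
next
  case fin: True
  define sgn where "sgn j l = (- 1 :: int) ^ card {m \<in> J. m < j} * (- 1) ^ card {m \<in> J - {j}. m < l}" for j l
  define T where "T = (SIGMA j:J. J - {j})"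
  define f where "f = (\<lambda>(j, l). frag_cmul (sgn j l) (frag_of (J - {j, l}, s)))"
  have "boundary (contraction (J, s)) =
      (\<Sum>j\<in>J. frag_cmul ((- 1) ^ card {m \<in> J. m < j}) (contraction (J - {j}, s)))"
    using fin by (simp add: contraction_def[of] frag_extend_sum frag_extend_cmul o_def)
  also have "\<dots> = (\<Sum>j\<in>J. \<Sum>l\<in>J - {j}. f (j, l))"
    by (simp add: contraction_def frag_cmul_sum f_def sgn_def insert_commute flip: Diff_insert)
  also have "\<dots> = sum f T"
    using fin by (simp add: T_def sum.Sigma)
  finally have eq: "boundary (contraction (J, s)) = sum f T" .
  have anti: "sgn l j = - sgn j l" if "j \<in> J" "l \<in> J" "j \<noteq> l" for j l
    using sign_contraction_swap[OF fin, of j l] sign_contraction_swap[OF fin, of l j] that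
    unfolding sgn_def by (cases "j < l") auto
  have "sum f T = sum (\<lambda>x. f (prod.swap x)) T"
    by (rule sum.reindex_bij_witness[of _ prod.swap prod.swap]) (auto simp: T_def)
  also have "\<dots> = sum (\<lambda>x. - f x) T"
  proof (rule sum.cong)
    fix x assume "x \<in> T"
    then obtain j l where "x = (j, l)" "j \<in> J" "l \<in> J" "j \<noteq> l" by (auto simp: T_def)
    then show "f (prod.swap x) = - f x"
      using anti[of j l] by (simp add: f_def insert_commute)
  qed simp
  also have "\<dots> = - sum f T" by (rule sum_negf)
  finally have neg: "sum f T = - sum f T" .
  have "poly_mapping.lookup (sum f T) k = 0" for k
  proof -
    have "poly_mapping.lookup (sum f T) k = poly_mapping.lookup (- sum f T) k"
      using neg by (rule arg_cong)
    then show ?thesis by simp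
  qed
  then have "sum f T = 0" by (intro poly_mapping_eqI) simp
  then show ?thesis using eq by simp
qed

lemma boundary_boundary: "boundary (boundary c) = 0"
proof -
  have "Poly_Mapping.keys c \<subseteq> UNIV" by simp
  then show ?thesis
  proof (induction c rule: frag_induction)
    case (one x)
    then show ?case using boundary_contraction[of "fst x" "snd x"] by simp
  qed (auto simp: frag_extend_diff)
qed

lemma comm_group_face_chains [simp]: "comm_group (face_chains X p)"
  by (rule abelian_free_Abelian_group)

lemma reverse_in_oriented_faces [simp]: "(J, - s) \<in> oriented_faces X p \<longleftrightarrow> (J, s) \<in> oriented_faces X p"
  by (auto simp: oriented_faces_def)

lemma orientation_generators_in_carrier:
  "(\<lambda>(J, s). frag_of (J, - s) + frag_of (J, s)) ` oriented_faces X p \<subseteq> carrier (face_chains X p)"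
proof -
  have "Poly_Mapping.keys (frag_of (J, - s) + frag_of (J, s)) \<subseteq> oriented_faces X p"
    if "(J, s) \<in> oriented_faces X p" for J and s :: int
    using that by (intro order_trans[OF keys_add]) (auto simp: keys_frag_of)
  then show ?thesis by auto
qed

lemma subgroup_orientation_relations [simp]: "subgroup (orientation_relations X p) (face_chains X p)"
  unfolding orientation_relations_def
  by (rule group.generate_is_subgroup[OF group_free_Abelian_group orientation_generators_in_carrier])

lemma keys_orientation_relations:
  "r \<in> orientation_relations X p \<Longrightarrow> Poly_Mapping.keys r \<subseteq> oriented_faces X p"
  using subgroup.subset[OF subgroup_orientation_relations] by (metis carrier_free_Abelian_group_iff subsetD)

lemma add_orientation_relations:
  "r \<in> orientation_relations X p \<Longrightarrow> r' \<in> orientation_relations X p \<Longrightarrow> r + r' \<in> orientation_relations X p"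
  using subgroup.m_closed[OF subgroup_orientation_relations] by fastforce

lemma uminus_orientation_relations:
  "r \<in> orientation_relations X p \<Longrightarrow> - r \<in> orientation_relations X p"
  using subgroup.m_inv_closed[OF subgroup_orientation_relations] keys_orientation_relations by fastforce

lemma zero_orientation_relations [simp]: "0 \<in> orientation_relations X p"
  using subgroup.one_closed[OF subgroup_orientation_relations[of X p]] by simp

lemma orientation_relations_induct [consumes 1, case_names reverse zero add uminus]:
  assumes "r \<in> orientation_relations X p"
    and "\<And>J s. (J, s) \<in> oriented_faces X p \<Longrightarrow> P (frag_of (J, - s) + frag_of (J, s))"
    and "P 0"
    and "\<And>r r'. r \<in> orientation_relations X p \<Longrightarrow> r' \<in> orientation_relations X p \<Longrightarrow> P r \<Longrightarrow> P r' \<Longrightarrow> P (r + r')"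
    and "\<And>r. r \<in> orientation_relations X p \<Longrightarrow> P r \<Longrightarrow> P (- r)"
  shows "P r"
proof -
  let ?G = "(\<lambda>(J, s). frag_of (J, - s) + frag_of (J, s)) ` oriented_faces X p"
  have "r \<in> generate (face_chains X p) ?G" using assms(1) by (simp add: orientation_relations_def)
  then show ?thesis
  proof (induction rule: generate.induct)
    case one
    then show ?case using assms(3) by simp
  next
    case (incl h)
    then show ?case using assms(2) by auto
  next
    case (inv h)
    have "h \<in> orientation_relations X p"
      unfolding orientation_relations_def by (rule generate.incl[OF inv])
    moreover have "P h" using inv assms(2) by auto
    ultimately show ?case using assms(5) keys_orientation_relations by fastforce
  next
    case (eng h1 h2)
    then show ?case using assms(4) by (simp add: orientation_relations_def)
  qed
qed

lemma boundary_orientation_relations: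
  assumes "r \<in> orientation_relations X p"
  shows "boundary r \<in> orientation_relations X (p - 1)"
  using assms
proof (induction rule: orientation_relations_induct)
  case (reverse J s)
  have fin: "finite J" and J: "J \<subseteq> {1..num X}" "face X J \<noteq> {}" "card J = p" "s \<in> {1, - 1}"
    using reverse by (auto simp: oriented_faces_def intro: finite_subset)
  have "boundary (frag_of (J, - s) + frag_of (J, s)) = (\<Sum>j\<in>J. frag_cmul ((- 1) ^ card {l \<in> J. l < j})
      (frag_of (J - {j}, - s) + frag_of (J - {j}, s)))"
    by (simp add: frag_extend_add contraction_def frag_cmul_distrib2 sum.distrib)
  also have "\<dots> \<in> orientation_relations X (p - 1)"
  proof -
    have term_in: "frag_cmul ((- 1) ^ k) (frag_of (J - {j}, - s) + frag_of (J - {j}, s))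
        \<in> orientation_relations X (p - 1)" if "j \<in> J" for j k
    proof -
      have "(J - {j}, s) \<in> oriented_faces X (p - 1)"
        using J that fin face_antimono[of "J - {j}" J X] by (auto simp: oriented_faces_def)
      then have "frag_of (J - {j}, - s) + frag_of (J - {j}, s) \<in> orientation_relations X (p - 1)"
        unfolding orientation_relations_def by (intro generate.incl) auto
      then show ?thesis
        using uminus_orientation_relations by (cases "even k") (auto simp del: minus_add_distrib)
    qed
    have "(\<Sum>j\<in>G. frag_cmul ((- 1) ^ card {l \<in> J. l < j}) (frag_of (J - {j}, - s) + frag_of (J - {j}, s)))
        \<in> orientation_relations X (p - 1)" if "G \<subseteq> J" for G
      using finite_subset[OF that fin] that
      by (induction G rule: finite_induct) (use term_in in \<open>auto intro: add_orientation_relations\<close>)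
    then show ?thesis by blast
  qed
  finally show ?case .
qed (auto simp: frag_extend_add frag_extend_minus intro: add_orientation_relations uminus_orientation_relations)

lemma orientation_class_eq_iff:
  assumes "Poly_Mapping.keys c \<subseteq> oriented_faces X p" "Poly_Mapping.keys c' \<subseteq> oriented_faces X p"
  shows "orientation_relations X p #>\<^bsub>face_chains X p\<^esub> c = orientation_relations X p #>\<^bsub>face_chains X p\<^esub> c'
    \<longleftrightarrow> c - c' \<in> orientation_relations X p"
proof
  assume "orientation_relations X p #>\<^bsub>face_chains X p\<^esub> c = orientation_relations X p #>\<^bsub>face_chains X p\<^esub> c'"
  moreover have "c \<in> orientation_relations X p #>\<^bsub>face_chains X p\<^esub> c"
    using assms by (intro group.rcos_self) auto
  ultimately obtain r where "r \<in> orientation_relations X p" "c = r + c'"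
    by (auto simp: r_coset_def)
  then show "c - c' \<in> orientation_relations X p" by simp
next
  assume "c - c' \<in> orientation_relations X p"
  then have "c \<in> orientation_relations X p #>\<^bsub>face_chains X p\<^esub> c'"
    by (auto simp: r_coset_def intro!: bexI[of _ "c - c'"])
  then show "orientation_relations X p #>\<^bsub>face_chains X p\<^esub> c = orientation_relations X p #>\<^bsub>face_chains X p\<^esub> c'"
    using assms by (intro group.repr_independence[symmetric]) auto
qed

abbreviation orientation_class :: "'a corner_data \<Rightarrow> nat \<Rightarrow> (oriented_face \<Rightarrow>\<^sub>0 int) \<Rightarrow> (oriented_face \<Rightarrow>\<^sub>0 int) set"
  where "orientation_class X p c \<equiv> orientation_relations X p #>\<^bsub>face_chains X p\<^esub> c"

lemma comm_group_conormal_chains [simp]: "comm_group (conormal_chains X p)"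
  unfolding conormal_chains_def by (intro comm_group.abelian_FactGroup) auto

lemma group_conormal_chains [simp]: "group (conormal_chains X p)"
  by (rule comm_group.axioms(2)[OF comm_group_conormal_chains])

lemma carrier_conormal_chains:
  "carrier (conormal_chains X p) = orientation_class X p ` {c. Poly_Mapping.keys c \<subseteq> oriented_faces X p}"
  unfolding conormal_chains_def carrier_FactGroup by (simp add: free_Abelian_group_def)

lemma orientation_class_hom: "orientation_class X p \<in> hom (face_chains X p) (conormal_chains X p)"
  unfolding conormal_chains_def
  by (intro normal.r_coset_hom_Mod comm_group.subgroup_imp_normal) auto

text \<open>
The differential was defined on cosets as a union; since \<open>boundary\<close> preserves the orientation
relations, all members of the union coincide, and it can be computed on any representative.
\<close>

lemma conormal_differential_class:
  assumes "Poly_Mapping.keys c \<subseteq> oriented_faces X p"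
  shows "conormal_differential X p (orientation_class X p c) = orientation_class X (p - 1) (boundary c)"
proof -
  have "orientation_class X (p - 1) (boundary c') = orientation_class X (p - 1) (boundary c)"
    if "c' \<in> orientation_class X p c" for c'
  proof -
    obtain r where r: "r \<in> orientation_relations X p" "c' = r + c"
      using \<open>c' \<in> _\<close> by (auto simp: r_coset_def)
    have "Poly_Mapping.keys c' \<subseteq> oriented_faces X p"
      unfolding r(2) by (intro order_trans[OF keys_add] Un_least keys_orientation_relations r assms)
    moreover have "boundary c' - boundary c \<in> orientation_relations X (p - 1)"
      using boundary_orientation_relations[OF r(1)] by (simp add: r(2) frag_extend_add)
    ultimately show ?thesis
      using orientation_class_eq_iff[OF keys_boundary keys_boundary] assms by blast
  qed
  moreover have "c \<in> orientation_class X p c"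
    using assms by (intro group.rcos_self) auto
  ultimately show ?thesis unfolding conormal_differential_def by blast
qed

lemma conormal_differential_hom:
  "conormal_differential X p \<in> hom (conormal_chains X p) (conormal_chains X (p - 1))"
proof (rule homI)
  fix K assume "K \<in> carrier (conormal_chains X p)"
  then obtain c where c: "Poly_Mapping.keys c \<subseteq> oriented_faces X p" "K = orientation_class X p c"
    by (auto simp: carrier_conormal_chains)
  show "conormal_differential X p K \<in> carrier (conormal_chains X (p - 1))"
    unfolding c(2) conormal_differential_class[OF c(1)] carrier_conormal_chains
    using keys_boundary[OF c(1)] by blast
  fix L assume "L \<in> carrier (conormal_chains X p)"
  then obtain e where e: "Poly_Mapping.keys e \<subseteq> oriented_faces X p" "L = orientation_class X p e"
    by (auto simp: carrier_conormal_chains)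
  have ce: "Poly_Mapping.keys (c + e) \<subseteq> oriented_faces X p"
    by (intro order_trans[OF keys_add] Un_least c e)
  have "K \<otimes>\<^bsub>conormal_chains X p\<^esub> L = orientation_class X p (c + e)"
    using hom_mult[OF orientation_class_hom, of c X p e] c e by simp
  moreover have "orientation_class X (p - 1) (boundary c) \<otimes>\<^bsub>conormal_chains X (p - 1)\<^esub>
      orientation_class X (p - 1) (boundary e) = orientation_class X (p - 1) (boundary c + boundary e)"
    using hom_mult[OF orientation_class_hom, of "boundary c" X "p - 1" "boundary e"]
      keys_boundary[OF c(1)] keys_boundary[OF e(1)] by simp
  ultimately show "conormal_differential X p (K \<otimes>\<^bsub>conormal_chains X p\<^esub> L) =
      conormal_differential X p K \<otimes>\<^bsub>conormal_chains X (p - 1)\<^esub> conormal_differential X p L"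
    by (simp only: conormal_differential_class[OF ce] conormal_differential_class[OF c(1)]
        conormal_differential_class[OF e(1)] c(2) e(2) frag_extend_add)
qed

lemma one_conormal_chains: "\<one>\<^bsub>conormal_chains X p\<^esub> = orientation_class X p 0"
  using group.coset_join2[of "face_chains X p" 0 "orientation_relations X p"]
  by (simp add: conormal_chains_def)

lemma group_hom_conormal_differential:
  "group_hom (conormal_chains X p) (conormal_chains X (p - 1)) (conormal_differential X p)"
  by (intro group_hom.intro group_hom_axioms.intro group_conormal_chains conormal_differential_hom)

lemma subgroup_conormal_cycles [simp]: "subgroup (conormal_cycles X p) (conormal_chains X p)"
  unfolding conormal_cycles_def by (rule group_hom.subgroup_kernel[OF group_hom_conormal_differential])

lemma subgroup_conormal_boundaries [simp]: "subgroup (conormal_boundaries X p) (conormal_chains X p)"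
  unfolding conormal_boundaries_def
  using group_hom.img_is_subgroup[OF group_hom_conormal_differential[of X "Suc p"]] by simp

lemma class_in_conormal_cycles:
  assumes "Poly_Mapping.keys c \<subseteq> oriented_faces X p" "boundary c = 0"
  shows "orientation_class X p c \<in> conormal_cycles X p"
  using assms by (auto simp: conormal_cycles_def kernel_def carrier_conormal_chains
      conormal_differential_class one_conormal_chains)

lemma conormal_boundaries_eq:
  "conormal_boundaries X p =
    (\<lambda>e. orientation_class X p (boundary e)) ` {e. Poly_Mapping.keys e \<subseteq> oriented_faces X (Suc p)}"
  unfolding conormal_boundaries_def carrier_conormal_chains image_image
proof (rule image_cong[OF refl])
  fix e :: "oriented_face \<Rightarrow>\<^sub>0 int"
  assume "e \<in> {e. Poly_Mapping.keys e \<subseteq> oriented_faces X (Suc p)}"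
  then show "conormal_differential X (Suc p) (orientation_class X (Suc p) e) = orientation_class X p (boundary e)"
    using conormal_differential_class[of e X "Suc p"] by simp
qed

lemma conormal_boundaries_subset_cycles: "conormal_boundaries X p \<subseteq> conormal_cycles X p"
  unfolding conormal_boundaries_eq
proof clarify
  fix e :: "oriented_face \<Rightarrow>\<^sub>0 int"
  assume "Poly_Mapping.keys e \<subseteq> oriented_faces X (Suc p)"
  then have "Poly_Mapping.keys (boundary e) \<subseteq> oriented_faces X p"
    using keys_boundary[of e X "Suc p"] by simp
  then show "orientation_class X p (boundary e) \<in> conormal_cycles X p"
    using boundary_boundary by (rule class_in_conormal_cycles)
qed

lemma normal_boundaries_in_cycles:
  "conormal_boundaries X p \<lhd> (conormal_chains X p)\<lparr>carrier := conormal_cycles X p\<rparr>"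
proof -
  have "comm_group ((conormal_chains X p)\<lparr>carrier := conormal_cycles X p\<rparr>)"
  proof (rule group.group_comm_groupI)
    show "group ((conormal_chains X p)\<lparr>carrier := conormal_cycles X p\<rparr>)"
      by (rule subgroup.subgroup_is_group[OF subgroup_conormal_cycles group_conormal_chains])
    fix K L
    assume "K \<in> carrier ((conormal_chains X p)\<lparr>carrier := conormal_cycles X p\<rparr>)"
      "L \<in> carrier ((conormal_chains X p)\<lparr>carrier := conormal_cycles X p\<rparr>)"
    then have "K \<in> carrier (conormal_chains X p)" "L \<in> carrier (conormal_chains X p)"
      using subgroup.subset[OF subgroup_conormal_cycles[of X p]] by auto
    then have "K \<otimes>\<^bsub>conormal_chains X p\<^esub> L = L \<otimes>\<^bsub>conormal_chains X p\<^esub> K"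
      by (rule comm_monoid.m_comm[OF comm_group.axioms(1)[OF comm_group_conormal_chains]])
    then show "K \<otimes>\<^bsub>(conormal_chains X p)\<lparr>carrier := conormal_cycles X p\<rparr>\<^esub> L =
        L \<otimes>\<^bsub>(conormal_chains X p)\<lparr>carrier := conormal_cycles X p\<rparr>\<^esub> K" by simp
  qed
  moreover have "subgroup (conormal_boundaries X p) ((conormal_chains X p)\<lparr>carrier := conormal_cycles X p\<rparr>)"
    by (intro group.subgroup_incl conormal_boundaries_subset_cycles) auto
  ultimately show ?thesis by (rule comm_group.subgroup_imp_normal)
qed

lemma group_conormal_homology_degree [simp]: "group (conormal_homology_degree X p)"
  unfolding conormal_homology_degree_def
  by (rule normal.factorgroup_is_group[OF normal_boundaries_in_cycles])

definition homology_class :: "'a corner_data \<Rightarrow> nat \<Rightarrow> (oriented_face \<Rightarrow>\<^sub>0 int) \<Rightarrow> (oriented_face \<Rightarrow>\<^sub>0 int) set set"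
  where "homology_class X p c = conormal_boundaries X p #>\<^bsub>conormal_chains X p\<^esub> orientation_class X p c"

lemma cycles_r_coset:
  "r_coset ((conormal_chains X p)\<lparr>carrier := Z\<rparr>) B K = r_coset (conormal_chains X p) B K"
  by (simp add: r_coset_def)

lemma homology_class_in_carrier:
  assumes "Poly_Mapping.keys c \<subseteq> oriented_faces X p" "boundary c = 0"
  shows "homology_class X p c \<in> carrier (conormal_homology_degree X p)"
  using class_in_conormal_cycles[OF assms]
  by (auto simp: homology_class_def conormal_homology_degree_def carrier_FactGroup cycles_r_coset)

lemma homology_class_add:
  assumes "Poly_Mapping.keys c \<subseteq> oriented_faces X p" "boundary c = 0"
    and "Poly_Mapping.keys e \<subseteq> oriented_faces X p" "boundary e = 0"
  shows "homology_class X p (c + e) =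
    homology_class X p c \<otimes>\<^bsub>conormal_homology_degree X p\<^esub> homology_class X p e"
proof -
  let ?Z = "(conormal_chains X p)\<lparr>carrier := conormal_cycles X p\<rparr>"
  have "orientation_class X p (c + e) = orientation_class X p c \<otimes>\<^bsub>conormal_chains X p\<^esub> orientation_class X p e"
    using hom_mult[OF orientation_class_hom, of c X p e] assms by simp
  then show ?thesis
    using hom_mult[OF normal.r_coset_hom_Mod[OF normal_boundaries_in_cycles[of X p]],
        of "orientation_class X p c" "orientation_class X p e"]
      class_in_conormal_cycles[OF assms(1,2)] class_in_conormal_cycles[OF assms(3,4)]
    by (simp add: homology_class_def conormal_homology_degree_def cycles_r_coset)
qed

lemma homology_class_boundary:
  assumes "Poly_Mapping.keys e \<subseteq> oriented_faces X (Suc p)"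
  shows "homology_class X p (boundary e) = \<one>\<^bsub>conormal_homology_degree X p\<^esub>"
proof -
  have "orientation_class X p (boundary e) \<in> conormal_boundaries X p"
    using assms by (auto simp: conormal_boundaries_eq)
  then show ?thesis
    using subgroup.rcos_const[OF subgroup_conormal_boundaries group_conormal_chains]
    by (simp add: homology_class_def conormal_homology_degree_def)
qed

lemma homology_class_eq_one:
  assumes "Poly_Mapping.keys c \<subseteq> oriented_faces X p"
    and "homology_class X p c = \<one>\<^bsub>conormal_homology_degree X p\<^esub>"
  obtains e where "Poly_Mapping.keys e \<subseteq> oriented_faces X (Suc p)" "c - boundary e \<in> orientation_relations X p"
proof -
  have "orientation_class X p c \<in> carrier (conormal_chains X p)"
    using assms(1) by (auto simp: carrier_conormal_chains)
  moreover have "conormal_boundaries X p #>\<^bsub>conormal_chains X p\<^esub> orientation_class X p c = conormal_boundaries X p"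
    using assms(2) by (simp add: homology_class_def conormal_homology_degree_def)
  ultimately have "orientation_class X p c \<in> conormal_boundaries X p"
    by (intro group.coset_join1[OF group_conormal_chains _ _ subgroup_conormal_boundaries])
  then obtain e where e: "Poly_Mapping.keys e \<subseteq> oriented_faces X (Suc p)"
    "orientation_class X p c = orientation_class X p (boundary e)"
    by (auto simp: conormal_boundaries_eq)
  moreover have "Poly_Mapping.keys (boundary e) \<subseteq> oriented_faces X p"
    using keys_boundary[OF e(1)] by simp
  ultimately show ?thesis
    using that orientation_class_eq_iff[OF assms(1)] by blast
qed

text \<open>
The classes of the cycles \<open>z g\<close> form a homomorphic image of \<open>A\<close>, because \<open>z\<close> is additive up to
boundaries. The cocycle \<open>\<phi>\<close> descends to homology and recovers \<open>g\<close> from the class of \<open>z g\<close>, so the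
map is injective. In the total homology it is placed in degree \<open>p\<close>.
\<close>

lemma embeds_in_conormal_homology:
  fixes A :: "('b, 'm) monoid_scheme"
  assumes A: "comm_group A"
    and cycle: "\<And>g. g \<in> carrier A \<Longrightarrow> Poly_Mapping.keys (z g) \<subseteq> oriented_faces X p"
      "\<And>g. g \<in> carrier A \<Longrightarrow> boundary (z g) = 0"
    and filling: "\<And>g h. g \<in> carrier A \<Longrightarrow> h \<in> carrier A \<Longrightarrow>
      \<exists>e. Poly_Mapping.keys e \<subseteq> oriented_faces X (Suc p) \<and> z g + z h = z (g \<otimes>\<^bsub>A\<^esub> h) + boundary e"
    and \<phi>: "\<phi> \<in> hom (face_chains X p) A"
    and reverse: "\<And>J s. (J, s) \<in> oriented_faces X p \<Longrightarrow>
      \<phi> (frag_of (J, - s)) \<otimes>\<^bsub>A\<^esub> \<phi> (frag_of (J, s)) = \<one>\<^bsub>A\<^esub>"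
    and cocycle: "\<And>x. x \<in> oriented_faces X (Suc p) \<Longrightarrow> \<phi> (contraction x) = \<one>\<^bsub>A\<^esub>"
    and evaluation: "\<And>g. g \<in> carrier A \<Longrightarrow> \<phi> (z g) = g"
  shows "\<exists>S. subgroup S (conormal_homology X) \<and> (conormal_homology X)\<lparr>carrier := S\<rparr> \<cong> A"
proof -
  interpret A: comm_group A by (rule A)
  let ?H = "conormal_homology_degree X p"
  interpret H: group ?H by simp
  interpret \<phi>: group_hom "face_chains X p" A \<phi>
    by (intro group_hom.intro group_hom_axioms.intro \<phi> A.is_group) simp
  have phi_add: "\<phi> (c + e) = \<phi> c \<otimes>\<^bsub>A\<^esub> \<phi> e"
    if "Poly_Mapping.keys c \<subseteq> oriented_faces X p" "Poly_Mapping.keys e \<subseteq> oriented_faces X p" for c e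
    using \<phi>.hom_mult[of c e] that by simp
  have neg: "\<phi> (- c) = inv\<^bsub>A\<^esub> \<phi> c" if "Poly_Mapping.keys c \<subseteq> oriented_faces X p" for c
    using \<phi>.hom_inv[of c] that by simp
  have zero: "\<phi> 0 = \<one>\<^bsub>A\<^esub>" using \<phi>.hom_one by simp
  have rel: "\<phi> r = \<one>\<^bsub>A\<^esub>" if "r \<in> orientation_relations X p" for r
    using that
  proof (induction rule: orientation_relations_induct)
    case (reverse J s)
    then show ?case
      using phi_add[of "frag_of (J, - s)" "frag_of (J, s)"] assms(6) by (simp add: keys_frag_of)
  next
    case (add r r')
    then show ?case using phi_add[OF add(1,2)[THEN keys_orientation_relations]] by simp
  next
    case (uminus r)
    then show ?case using neg[OF uminus(1)[THEN keys_orientation_relations]] by simp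
  qed (rule zero)
  have bnd: "\<phi> (boundary e) = \<one>\<^bsub>A\<^esub>" if "Poly_Mapping.keys e \<subseteq> oriented_faces X (Suc p)" for e
    using that
  proof (induction rule: free_Abelian_group_induct[consumes 1])
    case 1
    show ?case by (simp add: zero)
  next
    case (2 x y)
    have "Poly_Mapping.keys (boundary x) \<subseteq> oriented_faces X p" "Poly_Mapping.keys (boundary y) \<subseteq> oriented_faces X p"
      using keys_boundary[OF 2(1)] keys_boundary[OF 2(2)] by simp_all
    then show ?case
      using phi_add[of "boundary x" "- boundary y"] neg[of "boundary y"] 2(3,4) by (simp add: frag_extend_diff)
  next
    case (3 a)
    then show ?case using cocycle by simp
  qed
  define h where "h g = homology_class X p (z g)" for g
  have h_closed: "h g \<in> carrier ?H" if "g \<in> carrier A" for g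
    unfolding h_def by (rule homology_class_in_carrier[OF cycle[OF that]])
  have h_mult: "h (g \<otimes>\<^bsub>A\<^esub> g') = h g \<otimes>\<^bsub>?H\<^esub> h g'" if g: "g \<in> carrier A" "g' \<in> carrier A" for g g'
  proof -
    obtain e where e: "Poly_Mapping.keys e \<subseteq> oriented_faces X (Suc p)"
      "z g + z g' = z (g \<otimes>\<^bsub>A\<^esub> g') + boundary e" using filling[OF g] by blast
    have gg: "g \<otimes>\<^bsub>A\<^esub> g' \<in> carrier A" using g by simp
    have "h g \<otimes>\<^bsub>?H\<^esub> h g' = homology_class X p (z g + z g')"
      unfolding h_def by (rule homology_class_add[symmetric]) (use g cycle in auto)
    also have "\<dots> = h (g \<otimes>\<^bsub>A\<^esub> g') \<otimes>\<^bsub>?H\<^esub> homology_class X p (boundary e)"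
      unfolding e(2) h_def
      by (rule homology_class_add[OF cycle[OF gg] _ boundary_boundary])
        (use keys_boundary[OF e(1)] in simp)
    finally show ?thesis
      using h_closed[OF gg] by (simp add: homology_class_boundary[OF e(1)])
  qed
  have h_inj: "g = \<one>\<^bsub>A\<^esub>" if g: "g \<in> carrier A" "h g = \<one>\<^bsub>?H\<^esub>" for g
  proof -
    obtain e where e: "Poly_Mapping.keys e \<subseteq> oriented_faces X (Suc p)"
      "z g - boundary e \<in> orientation_relations X p"
      using homology_class_eq_one[OF cycle(1)[OF g(1)]] g(2) unfolding h_def by blast
    have "Poly_Mapping.keys (boundary e) \<subseteq> oriented_faces X p" using keys_boundary[OF e(1)] by simp
    then have "\<phi> (z g - boundary e + boundary e) = \<phi> (z g - boundary e) \<otimes>\<^bsub>A\<^esub> \<phi> (boundary e)"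
      by (rule phi_add[OF keys_orientation_relations[OF e(2)]])
    then have "\<phi> (z g) = \<one>\<^bsub>A\<^esub>" using rel[OF e(2)] bnd[OF e(1)] by simp
    then show ?thesis using evaluation[OF g(1)] by simp
  qed
  define k where "k g = (\<lambda>q\<in>UNIV. if q = p then h g else \<one>\<^bsub>conormal_homology_degree X q\<^esub>)" for g
  let ?T = "conormal_homology X"
  have gT: "group ?T" unfolding conormal_homology_def by simp
  have k_hom: "k \<in> hom A ?T"
  proof (rule homI)
    fix g assume g: "g \<in> carrier A"
    have "finite {q. k g q \<noteq> \<one>\<^bsub>conormal_homology_degree X q\<^esub>}"
      by (rule finite_subset[of _ "{p}"]) (auto simp: k_def)
    then show "k g \<in> carrier ?T"
      using h_closed[OF g]
      by (auto simp: conormal_homology_def carrier_sum_group k_def group.is_monoid monoid.one_closed)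
    fix g' assume g': "g' \<in> carrier A"
    show "k (g \<otimes>\<^bsub>A\<^esub> g') = k g \<otimes>\<^bsub>?T\<^esub> k g'"
      using h_mult[OF g g'] by (auto simp: conormal_homology_def k_def fun_eq_iff group.is_monoid)
  qed
  then interpret k: group_hom A ?T k
    by (intro group_hom.intro group_hom_axioms.intro gT A.is_group)
  have "g = \<one>\<^bsub>A\<^esub>" if "g \<in> carrier A" "k g = \<one>\<^bsub>?T\<^esub>" for g
  proof (rule h_inj[OF that(1)])
    have "k g p = \<one>\<^bsub>?T\<^esub> p" using that(2) by simp
    then show "h g = \<one>\<^bsub>?H\<^esub>" by (simp add: k_def conormal_homology_def)
  qed
  then have "inj_on k (carrier A)" using k.inj_on_one_iff by blast
  then have "k \<in> iso A (?T\<lparr>carrier := k ` carrier A\<rparr>)"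
    using k_hom by (auto simp: iso_def hom_def bij_betw_def)
  then have "?T\<lparr>carrier := k ` carrier A\<rparr> \<cong> A"
    using A.iso_sym[of "?T\<lparr>carrier := k ` carrier A\<rparr>"] by (auto simp: is_iso_def)
  moreover have "subgroup (k ` carrier A) ?T" by (rule k.img_is_subgroup)
  ultimately show ?thesis by blast
qed


section \<open>A triangulated complex carrying a given abelian group\<close>

lemma contraction_pair:
  assumes "i < j"
  shows "contraction ({i, j}, s) = frag_of ({j}, s) - frag_of ({i}, s)"
proof -
  have c: "{l \<in> {i, j}. l < i} = {}" "{l \<in> {i, j}. l < j} = {i}"
    and d: "{i, j} - {i} = {j}" "{i, j} - {j} = {i}"
    using assms by auto
  have "contraction ({i, j}, s) =
      (\<Sum>m\<in>{i, j}. frag_cmul ((- 1) ^ card {l \<in> {i, j}. l < m}) (frag_of ({i, j} - {m}, s)))"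
    by (simp only: contraction_def prod.case)
  also have "\<dots> = frag_cmul ((- 1) ^ card {l \<in> {i, j}. l < i}) (frag_of ({i, j} - {i}, s))
      + frag_cmul ((- 1) ^ card {l \<in> {i, j}. l < j}) (frag_of ({i, j} - {j}, s))"
    using assms by (subst sum.insert; simp)
  also have "\<dots> = frag_of ({j}, s) - frag_of ({i}, s)"
    unfolding c d by simp
  finally show ?thesis .
qed

lemma contraction_triple:
  assumes "i < j" "j < k"
  shows "contraction ({i, j, k}, s) = frag_of ({j, k}, s) - frag_of ({i, k}, s) + frag_of ({i, j}, s)"
proof -
  have c: "{l \<in> {i, j, k}. l < i} = {}" "{l \<in> {i, j, k}. l < j} = {i}" "{l \<in> {i, j, k}. l < k} = {i, j}"
    and d: "{i, j, k} - {i} = {j, k}" "{i, j, k} - {j} = {i, k}" "{i, j, k} - {k} = {i, j}"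
    using assms by auto
  have "contraction ({i, j, k}, s) =
      (\<Sum>m\<in>{i, j, k}. frag_cmul ((- 1) ^ card {l \<in> {i, j, k}. l < m}) (frag_of ({i, j, k} - {m}, s)))"
    by (simp only: contraction_def prod.case)
  also have "\<dots> = frag_cmul ((- 1) ^ card {l \<in> {i, j, k}. l < i}) (frag_of ({i, j, k} - {i}, s))
      + (frag_cmul ((- 1) ^ card {l \<in> {i, j, k}. l < j}) (frag_of ({i, j, k} - {j}, s))
      + frag_cmul ((- 1) ^ card {l \<in> {i, j, k}. l < k}) (frag_of ({i, j, k} - {k}, s)))"
    using assms by (subst sum.insert; simp)
  also have "\<dots> = frag_of ({j, k}, s) - frag_of ({i, k}, s) + frag_of ({i, j}, s)"
    unfolding c d using assms by simp
  finally show ?thesis .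
qed

text \<open>
The signs in the conormal complex refer to the numbering of the hypersurfaces. A numbering by
increasing \<open>f\<close> makes them agree with the order of a chain of cells by dimension.
\<close>

lemma exists_monotone_numbering:
  fixes f :: "'c \<Rightarrow> nat"
  assumes "finite C"
  obtains e where "bij_betw e C {1..card C}" "\<And>c d. c \<in> C \<Longrightarrow> d \<in> C \<Longrightarrow> f c < f d \<Longrightarrow> e c < e d"
proof -
  obtain ys where ys: "set ys = C" "distinct ys" using finite_distinct_list[OF assms] by blast
  define xs where "xs = sort_key f ys"
  have xs: "set xs = C" "distinct xs" "sorted (map f xs)" by (simp_all add: xs_def ys)
  have len: "length xs = card C" using distinct_card[OF xs(2)] xs(1) by simp
  have bij: "bij_betw (\<lambda>i. xs ! i) {..<card C} C"
    by (rule bij_betw_nth[OF xs(2)]) (simp_all only: len xs(1))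
  define e where "e c = Suc (inv_into {..<card C} (\<lambda>i. xs ! i) c)" for c
  have inv: "bij_betw (inv_into {..<card C} (\<lambda>i. xs ! i)) C {..<card C}"
    by (rule bij_betw_inv_into[OF bij])
  have "bij_betw e C {1..card C}"
    unfolding e_def using bij_betw_trans[OF inv, of Suc "{1..card C}"]
    by (simp add: o_def bij_betw_def image_Suc_lessThan)
  moreover have "e c < e d" if cd: "c \<in> C" "d \<in> C" "f c < f d" for c d
  proof (rule ccontr)
    assume "\<not> e c < e d"
    moreover have at: "xs ! (e b - 1) = b \<and> e b - 1 < length xs" if "b \<in> C" for b
      using bij_betw_inv_into_right[OF bij that] bij_betwE[OF inv] that by (simp add: e_def len)
    ultimately have "map f xs ! (e d - 1) \<le> map f xs ! (e c - 1)"
      using at[OF cd(1)] by (intro sorted_nth_mono xs(3)) auto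
    then show False using at[OF cd(1)] at[OF cd(2)] cd(3) by simp
  qed
  ultimately show ?thesis by (rule that)
qed

text \<open>
The cells of the two-dimensional skeleton of the classifying space. The first argument of \<open>Edge\<close>
tells which pair of vertices the edge joins: \<open>0\<close> stands for \<open>01\<close>, \<open>1\<close> for \<open>12\<close>, and \<open>2\<close> for \<open>02\<close>.
\<close>

datatype 'g cell = Vertex nat | Edge nat 'g | Triangle 'g 'g

fun cell_dim :: "'g cell \<Rightarrow> nat" where
  "cell_dim (Vertex i) = 0"
| "cell_dim (Edge k g) = 1"
| "cell_dim (Triangle g h) = 2"

definition source :: "nat \<Rightarrow> nat" where "source k = (if k = 1 then 1 else 0)"
definition target :: "nat \<Rightarrow> nat" where "target k = (if k = 0 then 1 else 2)"

context comm_group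
begin

definition cells :: "'a cell set"
  where "cells = Vertex ` {..<3} \<union> (\<lambda>(k, g). Edge k g) ` ({..<3} \<times> carrier G)
    \<union> (\<lambda>(g, h). Triangle g h) ` (carrier G \<times> carrier G)"

definition side :: "nat \<Rightarrow> 'a \<Rightarrow> 'a \<Rightarrow> 'a"
  where "side k g h = (if k = 0 then g else if k = 1 then h else g \<otimes> h)"

fun incident :: "'a cell \<Rightarrow> 'a cell \<Rightarrow> bool" where
  "incident (Vertex i) (Edge k g) \<longleftrightarrow> i = source k \<or> i = target k"
| "incident (Vertex i) (Triangle g h) \<longleftrightarrow> True"
| "incident (Edge k a) (Triangle g h) \<longleftrightarrow> a = side k g h"
| "incident _ _ \<longleftrightarrow> False"

text \<open>
In the covering with group \<open>G\<close>, choose the lift of each edge that starts in the chosen lift of its source, and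
the lift of each triangle whose vertex \<open>0\<close> is the chosen one. The chosen lift of the larger of two
incident cells is incident to a translate of the chosen lift of the smaller one; the inverse of the
translating group element is recorded here.
\<close>

fun holonomy :: "'a cell \<Rightarrow> 'a cell \<Rightarrow> 'a" where
  "holonomy (Vertex i) (Edge k g) = (if i = source k then \<one> else inv g)"
| "holonomy (Vertex i) (Triangle g h) = (if i = 0 then \<one> else if i = 1 then inv g else inv (g \<otimes> h))"
| "holonomy (Edge k a) (Triangle g h) = (if k = 1 then inv g else \<one>)"
| "holonomy _ _ = \<one>"

lemma cells_simps [simp]:
  "Vertex i \<in> cells \<longleftrightarrow> i < 3"
  "Edge k g \<in> cells \<longleftrightarrow> k < 3 \<and> g \<in> carrier G"
  "Triangle g h \<in> cells \<longleftrightarrow> g \<in> carrier G \<and> h \<in> carrier G"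
  by (auto simp: cells_def)

lemma finite_cells: "finite (carrier G) \<Longrightarrow> finite cells"
  by (simp add: cells_def)

lemma incident_imp_dim_less: "incident c d \<Longrightarrow> cell_dim c < cell_dim d"
  by (cases c; cases d) auto

lemma cell_dim_le_2: "cell_dim c \<le> 2"
  by (cases c) auto

lemma holonomy_closed: "c \<in> cells \<Longrightarrow> d \<in> cells \<Longrightarrow> holonomy c d \<in> carrier G"
  by (cases c; cases d) auto

lemma holonomy_cocycle:
  assumes "a \<in> cells" "b \<in> cells" "c \<in> cells" "incident a b" "incident b c"
  shows "holonomy b c \<otimes> inv (holonomy a c) \<otimes> holonomy a b = \<one>"
proof -
  have "cell_dim a < cell_dim b" "cell_dim b < cell_dim c" using assms incident_imp_dim_less by auto
  then obtain i k x g h where abc: "a = Vertex i" "b = Edge k x" "c = Triangle g h"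
    using cell_dim_le_2[of c] by (cases a; cases b; cases c) auto
  have gh: "g \<in> carrier G" "h \<in> carrier G" "k < 3" using assms abc by auto
  then consider "k = 0" | "k = 1" | "k = 2" by linarith
  then show ?thesis
    using assms(4,5) gh unfolding abc
    by cases (auto simp: source_def target_def side_def m_assoc inv_mult m_lcomm m_comm)
qed

end

text \<open>
A manifold with corners whose hypersurfaces are numbered by the cells and whose nerve consists of
all pairs and of the triangles of the incidence graph.
\<close>

locale classifying_corners = comm_group +
  fixes e :: "'a cell \<Rightarrow> nat" and X :: "'x corner_data"
  assumes bij: "bij_betw e cells {1..num X}"
    and mono: "\<And>c d. c \<in> cells \<Longrightarrow> d \<in> cells \<Longrightarrow> cell_dim c < cell_dim d \<Longrightarrow> e c < e d"
    and face_iff: "\<And>J. J \<subseteq> {1..num X} \<Longrightarrow> face X J \<noteq> {} \<longleftrightarrow> J \<in> triangle_complex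
      (\<lambda>i j. \<exists>c\<in>cells. \<exists>d\<in>cells. (incident c d \<or> incident d c) \<and> i = e c \<and> j = e d)"
begin

abbreviation adjacent :: "nat \<Rightarrow> nat \<Rightarrow> bool"
  where "adjacent i j \<equiv> \<exists>c\<in>cells. \<exists>d\<in>cells. (incident c d \<or> incident d c) \<and> i = e c \<and> j = e d"

definition decode :: "nat \<Rightarrow> 'a cell" where "decode = inv_into cells e"

lemma decode_e [simp]: "c \<in> cells \<Longrightarrow> decode (e c) = c"
  unfolding decode_def using bij by (intro inv_into_f_f) (auto simp: bij_betw_def)

lemma decode_in_cells: "i \<in> {1..num X} \<Longrightarrow> decode i \<in> cells"
  unfolding decode_def using bij by (metis bij_betw_def inv_into_into)

lemma e_decode: "i \<in> {1..num X} \<Longrightarrow> e (decode i) = i"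
  unfolding decode_def by (rule bij_betw_inv_into_right[OF bij])

lemma e_in: "c \<in> cells \<Longrightarrow> e c \<in> {1..num X}"
  using bij by (rule bij_betw_apply)

definition vertex_symbol :: "'a cell \<Rightarrow> (oriented_face \<Rightarrow>\<^sub>0 int)" where "vertex_symbol c = frag_of ({e c}, 1)"
definition edge_symbol :: "'a cell \<Rightarrow> 'a cell \<Rightarrow> (oriented_face \<Rightarrow>\<^sub>0 int)" where "edge_symbol c d = frag_of ({e c, e d}, 1)"
definition triangle_symbol :: "'a cell \<Rightarrow> 'a cell \<Rightarrow> 'a cell \<Rightarrow> (oriented_face \<Rightarrow>\<^sub>0 int)"
  where "triangle_symbol b c d = frag_of ({e b, e c, e d}, 1)"

lemma boundary_edge_symbol: "c \<in> cells \<Longrightarrow> d \<in> cells \<Longrightarrow> cell_dim c < cell_dim d \<Longrightarrow> boundary (edge_symbol c d) = vertex_symbol d - vertex_symbol c"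
  by (simp add: edge_symbol_def vertex_symbol_def contraction_pair mono)

lemma boundary_triangle_symbol:
  "b \<in> cells \<Longrightarrow> c \<in> cells \<Longrightarrow> d \<in> cells \<Longrightarrow> cell_dim b < cell_dim c \<Longrightarrow> cell_dim c < cell_dim d \<Longrightarrow>
    boundary (triangle_symbol b c d) = edge_symbol c d - edge_symbol b d + edge_symbol b c"
  by (simp add: triangle_symbol_def edge_symbol_def contraction_triple mono)

lemma keys_edge_symbol:
  assumes "c \<in> cells" "d \<in> cells" "cell_dim c < cell_dim d"
  shows "Poly_Mapping.keys (edge_symbol c d) \<subseteq> oriented_faces X 2"
proof -
  have "card {e c, e d} = 2" using mono[OF assms] by simp
  moreover have "{e c, e d} \<subseteq> {1..num X}" using e_in assms by blast
  ultimately show ?thesis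
    using face_iff[of "{e c, e d}"] by (simp add: edge_symbol_def keys_frag_of oriented_faces_def triangle_complex_def)
qed

lemma keys_triangle_symbol:
  assumes "b \<in> cells" "c \<in> cells" "d \<in> cells" "incident b c" "incident c d" "incident b d"
  shows "Poly_Mapping.keys (triangle_symbol b c d) \<subseteq> oriented_faces X 3"
proof -
  have "e b < e c" "e c < e d" using mono assms incident_imp_dim_less by blast+
  then have "card {e b, e c, e d} = 3" by simp
  moreover have "{e b, e c, e d} \<subseteq> {1..num X}" using e_in assms by blast
  moreover have "clique adjacent {e b, e c, e d}"
    using assms unfolding clique_def by blast
  ultimately show ?thesis
    using face_iff[of "{e b, e c, e d}"] by (simp add: triangle_symbol_def keys_frag_of oriented_faces_def triangle_complex_def)
qed

text \<open>
An edge of the complex is subdivided at its barycentre into two segments, both directed from a vertex to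
the barycentre; hence the minus sign.
\<close>

definition edge_chain :: "nat \<Rightarrow> 'a \<Rightarrow> (oriented_face \<Rightarrow>\<^sub>0 int)"
  where "edge_chain k g = edge_symbol (Vertex (source k)) (Edge k g) - edge_symbol (Vertex (target k)) (Edge k g)"

definition loop :: "'a \<Rightarrow> (oriented_face \<Rightarrow>\<^sub>0 int)"
  where "loop g = edge_chain 0 g - edge_chain 0 \<one>"

text \<open>
A triangle of the complex is subdivided into six; \<open>star g h k\<close> is the pair of those which meet
its side \<open>k\<close>, oriented along that side.
\<close>

definition star :: "'a \<Rightarrow> 'a \<Rightarrow> nat \<Rightarrow> (oriented_face \<Rightarrow>\<^sub>0 int)"
  where "star g h k = triangle_symbol (Vertex (source k)) (Edge k (side k g h)) (Triangle g h)
    - triangle_symbol (Vertex (target k)) (Edge k (side k g h)) (Triangle g h)"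

definition triangle_chain :: "'a \<Rightarrow> 'a \<Rightarrow> (oriented_face \<Rightarrow>\<^sub>0 int)"
  where "triangle_chain g h = star g h 0 + star g h 1 - star g h 2"

lemma source_target_less [simp]: "source k < 3" "target k < 3"
  by (auto simp: source_def target_def)

lemma side_closed [simp]: "g \<in> carrier G \<Longrightarrow> h \<in> carrier G \<Longrightarrow> side k g h \<in> carrier G"
  by (simp add: side_def)

lemma keys_diff_subset: "Poly_Mapping.keys c \<subseteq> S \<Longrightarrow> Poly_Mapping.keys c' \<subseteq> S \<Longrightarrow> Poly_Mapping.keys (c - c') \<subseteq> S"
  using keys_diff[of c c'] by blast

lemma keys_add_subset: "Poly_Mapping.keys c \<subseteq> S \<Longrightarrow> Poly_Mapping.keys c' \<subseteq> S \<Longrightarrow> Poly_Mapping.keys (c + c') \<subseteq> S"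
  using keys_add[of c c'] by blast

lemma keys_edge_chain: "k < 3 \<Longrightarrow> g \<in> carrier G \<Longrightarrow> Poly_Mapping.keys (edge_chain k g) \<subseteq> oriented_faces X 2"
  unfolding edge_chain_def by (intro keys_diff_subset keys_edge_symbol) auto

lemma keys_loop: "g \<in> carrier G \<Longrightarrow> Poly_Mapping.keys (loop g) \<subseteq> oriented_faces X 2"
  unfolding loop_def by (intro keys_diff_subset keys_edge_chain) auto

lemma boundary_loop: "g \<in> carrier G \<Longrightarrow> boundary (loop g) = 0"
  by (simp add: loop_def edge_chain_def frag_extend_diff boundary_edge_symbol)

lemma keys_triangle_chain:
  assumes "g \<in> carrier G" "h \<in> carrier G"
  shows "Poly_Mapping.keys (triangle_chain g h) \<subseteq> oriented_faces X 3"
  unfolding triangle_chain_def star_def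
  by (intro keys_diff_subset keys_add_subset keys_triangle_symbol) (use assms in auto)

lemma boundary_star:
  assumes "g \<in> carrier G" "h \<in> carrier G" "k < 3"
  shows "boundary (star g h k) = edge_chain k (side k g h)
    - edge_symbol (Vertex (source k)) (Triangle g h) + edge_symbol (Vertex (target k)) (Triangle g h)"
  using assms by (simp add: star_def frag_extend_diff boundary_triangle_symbol edge_chain_def)

lemma boundary_triangle_chain:
  assumes "g \<in> carrier G" "h \<in> carrier G"
  shows "boundary (triangle_chain g h) = edge_chain 0 g + edge_chain 1 h - edge_chain 2 (g \<otimes> h)"
  using assms boundary_star[OF assms]
  by (simp add: triangle_chain_def frag_extend_diff frag_extend_add side_def source_def target_def)

text \<open>
Modulo boundaries \<open>edge_chain 0 g + edge_chain 1 h = edge_chain 2 (g \<otimes> h)\<close>. Using this for the pairs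
\<open>(g, h)\<close>, \<open>(g \<otimes> h, \<one>)\<close>, \<open>(h, \<one>)\<close> and \<open>(\<one>, h)\<close>, all edges over \<open>12\<close> and \<open>02\<close> cancel.
\<close>

lemma loop_filling:
  assumes g: "g \<in> carrier G" and h: "h \<in> carrier G"
  shows "\<exists>c. Poly_Mapping.keys c \<subseteq> oriented_faces X 3 \<and> loop g + loop h = loop (g \<otimes> h) + boundary c"
proof (intro exI conjI)
  let ?c = "triangle_chain g h - triangle_chain (g \<otimes> h) \<one> + triangle_chain h \<one> - triangle_chain \<one> h"
  show "Poly_Mapping.keys ?c \<subseteq> oriented_faces X 3"
    by (intro keys_diff_subset keys_add_subset keys_triangle_chain) (use g h in auto)
  show "loop g + loop h = loop (g \<otimes> h) + boundary ?c"
    using g h by (simp add: frag_extend_diff frag_extend_add boundary_triangle_chain loop_def)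
qed

text \<open>
By the monotone numbering, the minimum and the maximum of the index set of an edge of the
subdivision belong to the cell of lower and of higher dimension.
\<close>

definition label :: "oriented_face \<Rightarrow> 'a"
  where "label = (\<lambda>(J, s). let g = holonomy (decode (Min J)) (decode (Max J)) in if s = 1 then g else inv g)"

lemma label_closed: "label ` oriented_faces X 2 \<subseteq> carrier G"
proof clarify
  fix J s assume "(J, s) \<in> oriented_faces X 2"
  then have J: "J \<subseteq> {1..num X}" "finite J" "J \<noteq> {}"
    by (auto simp: oriented_faces_def intro: finite_subset)
  then have "decode (Min J) \<in> cells" "decode (Max J) \<in> cells"
    using decode_in_cells Min_in Max_in by blast+
  then show "label (J, s) \<in> carrier G"
    by (simp add: label_def Let_def holonomy_closed)
qed

lemma label_reverse:
  assumes "(J, s) \<in> oriented_faces X 2"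
  shows "label (J, - s) \<otimes> label (J, s) = \<one>"
proof -
  have "label (J, 1) \<in> carrier G" "s = 1 \<or> s = - 1"
    using assms label_closed by (auto simp: oriented_faces_def image_subset_iff)
  then show ?thesis by (auto simp: label_def Let_def)
qed

lemma label_pair:
  assumes "c \<in> cells" "d \<in> cells" "cell_dim c < cell_dim d"
  shows "label ({e c, e d}, s) = (if s = 1 then holonomy c d else inv (holonomy c d))"
  using mono[OF assms] assms by (simp add: label_def)

text \<open>
Incident cells differ in dimension, so three pairwise incident cells have dimensions \<open>0\<close>, \<open>1\<close> and \<open>2\<close>.
\<close>

lemma maximal_clique_cells:
  assumes "J \<subseteq> {1..num X}" "card J = 3" "clique adjacent J"
  obtains b c d where "b \<in> cells" "c \<in> cells" "d \<in> cells" "incident b c" "incident c d" "J = {e b, e c, e d}"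
proof -
  define D where "D i = cell_dim (decode i)" for i
  have adj: "incident (decode i) (decode j) \<or> incident (decode j) (decode i)"
    if "i \<in> J" "j \<in> J" "i \<noteq> j" for i j
    using assms(3) that unfolding clique_def by force
  have fin: "finite J" using assms(2) by (intro card_ge_0_finite) simp
  have "inj_on D J"
    using adj incident_imp_dim_less unfolding inj_on_def D_def by (metis less_irrefl)
  then have "card (D ` J) = 3" using assms(2) by (simp add: card_image)
  moreover have "D ` J \<subseteq> {..2}" using cell_dim_le_2 by (auto simp: D_def)
  ultimately have "D ` J = {..2}" by (intro card_subset_eq) auto
  then have "0 \<in> D ` J" "1 \<in> D ` J" "2 \<in> D ` J" by auto
  then obtain i j k where ijk: "i \<in> J" "D i = 0" "j \<in> J" "D j = 1" "k \<in> J" "D k = 2" by fastforce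
  have neq: "i \<noteq> j" "i \<noteq> k" "j \<noteq> k" using ijk(2,4,6) by auto
  then have "card {i, j, k} = 3" by simp
  then have "{i, j, k} = J"
    using ijk assms(2) fin by (intro card_subset_eq) simp_all
  moreover have "e (decode i) = i" "e (decode j) = j" "e (decode k) = k"
    using ijk assms(1) e_decode by blast+
  moreover have "incident (decode i) (decode j)" "incident (decode j) (decode k)"
    using adj[OF ijk(1,3) neq(1)] adj[OF ijk(3,5) neq(3)] ijk(2,4,6)
      incident_imp_dim_less[of "decode j" "decode i"] incident_imp_dim_less[of "decode k" "decode j"]
    by (auto simp: D_def)
  moreover have "decode i \<in> cells" "decode j \<in> cells" "decode k \<in> cells"
    using ijk assms(1) decode_in_cells by blast+
  ultimately show ?thesis by (intro that[of "decode i" "decode j" "decode k"]) simp_all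
qed

lemma group_embeds_in_conormal_homology:
  "\<exists>S. subgroup S (conormal_homology X) \<and> (conormal_homology X)\<lparr>carrier := S\<rparr> \<cong> G"
proof -
  obtain \<phi> where \<phi>: "\<phi> \<in> hom (face_chains X 2) G"
    and \<phi>_label: "\<And>y. y \<in> oriented_faces X 2 \<Longrightarrow> \<phi> (frag_of y) = label y"
    using free_Abelian_group_universal[OF label_closed] by blast
  interpret \<phi>: group_hom "face_chains X 2" G \<phi>
    by (intro group_hom.intro group_hom_axioms.intro \<phi> is_group) simp
  have \<phi>_add: "\<phi> (c + c') = \<phi> c \<otimes> \<phi> c'"
    if "Poly_Mapping.keys c \<subseteq> oriented_faces X 2" "Poly_Mapping.keys c' \<subseteq> oriented_faces X 2" for c c'
    using \<phi>.hom_mult[of c c'] that by simp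
  have \<phi>_diff: "\<phi> (c - c') = \<phi> c \<otimes> inv (\<phi> c')"
    if "Poly_Mapping.keys c \<subseteq> oriented_faces X 2" "Poly_Mapping.keys c' \<subseteq> oriented_faces X 2" for c c'
    using \<phi>_add[of c "- c'"] \<phi>.hom_inv[of c'] that by simp
  have \<phi>_edge_symbol: "\<phi> (frag_of ({e c, e d}, s)) = (if s = 1 then holonomy c d else inv (holonomy c d))"
    if "c \<in> cells" "d \<in> cells" "cell_dim c < cell_dim d" "s \<in> {1, - 1}" for c d s
  proof -
    have "({e c, e d}, s) \<in> oriented_faces X 2"
      using keys_edge_symbol[OF that(1-3)] that(4) by (auto simp: edge_symbol_def keys_frag_of oriented_faces_def)
    then show ?thesis using \<phi>_label label_pair[OF that(1-3)] by simp
  qed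
  have \<phi>_edge: "\<phi> (edge_chain 0 g) = g" if "g \<in> carrier G" for g
  proof -
    have "\<phi> (edge_chain 0 g) = \<phi> (edge_symbol (Vertex (source 0)) (Edge 0 g)) \<otimes> inv (\<phi> (edge_symbol (Vertex (target 0)) (Edge 0 g)))"
      unfolding edge_chain_def by (intro \<phi>_diff keys_edge_symbol) (use that in auto)
    then show ?thesis
      using that by (simp add: edge_symbol_def \<phi>_edge_symbol) (simp add: source_def target_def)
  qed
  show ?thesis
  proof (rule embeds_in_conormal_homology[OF comm_group_axioms, of loop X 2 \<phi>])
    show "\<phi> (loop g) = g" if "g \<in> carrier G" for g
    proof -
      have "\<phi> (loop g) = \<phi> (edge_chain 0 g) \<otimes> inv (\<phi> (edge_chain 0 \<one>))"
        unfolding loop_def by (intro \<phi>_diff keys_edge_chain) (use that in simp_all)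
      then show ?thesis using that by (simp add: \<phi>_edge)
    qed
    show "\<phi> (frag_of (J, - s)) \<otimes> \<phi> (frag_of (J, s)) = \<one>" if "(J, s) \<in> oriented_faces X 2" for J s
      using label_reverse[OF that] \<phi>_label that by simp
    fix x assume "x \<in> oriented_faces X (Suc 2)"
    then obtain J s where x: "x = (J, s)" "J \<subseteq> {1..num X}" "card J = 3" "face X J \<noteq> {}" "s \<in> {1, - 1}"
      by (auto simp: oriented_faces_def)
    have "clique adjacent J"
      using face_iff[OF x(2)] x(3,4) by (simp add: triangle_complex_def)
    then obtain b c d where bcd: "b \<in> cells" "c \<in> cells" "d \<in> cells" "incident b c" "incident c d"
      and J: "J = {e b, e c, e d}"
      using maximal_clique_cells[OF x(2,3)] by blast
    have dims: "cell_dim b < cell_dim c" "cell_dim c < cell_dim d" "cell_dim b < cell_dim d"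
      using incident_imp_dim_less[OF bcd(4)] incident_imp_dim_less[OF bcd(5)] by auto
    have keys: "Poly_Mapping.keys (frag_of ({e u, e v}, s)) \<subseteq> oriented_faces X 2"
      if "u \<in> cells" "v \<in> cells" "cell_dim u < cell_dim v" for u v
      using keys_edge_symbol[OF that] x(5) by (auto simp: edge_symbol_def keys_frag_of oriented_faces_def)
    have "\<phi> (contraction x) = \<phi> (frag_of ({e c, e d}, s)) \<otimes> inv (\<phi> (frag_of ({e b, e d}, s)))
        \<otimes> \<phi> (frag_of ({e b, e c}, s))"
      unfolding x(1) J contraction_triple[OF mono[OF bcd(1,2) dims(1)] mono[OF bcd(2,3) dims(2)]]
      using \<phi>_add[OF keys_diff_subset[OF keys[OF bcd(2,3) dims(2)] keys[OF bcd(1,3) dims(3)]]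
          keys[OF bcd(1,2) dims(1)]]
        \<phi>_diff[OF keys[OF bcd(2,3) dims(2)] keys[OF bcd(1,3) dims(3)]] by simp
    also have "\<dots> = \<one>"
    proof -
      let ?u = "holonomy c d" and ?v = "holonomy b d" and ?w = "holonomy b c"
      have uvw: "?u \<in> carrier G" "?v \<in> carrier G" "?w \<in> carrier G"
        using holonomy_closed bcd by auto
      have "?u \<otimes> inv ?v \<otimes> ?w = \<one>"
        by (rule holonomy_cocycle[OF bcd])
      moreover from this have "inv ?u \<otimes> inv (inv ?v) \<otimes> inv ?w = \<one>"
        using uvw by (metis inv_closed inv_mult inv_one m_closed)
      ultimately show ?thesis
        using x(5) bcd dims by (auto simp: \<phi>_edge_symbol)
    qed
    finally show "\<phi> (contraction x) = \<one>" .
  qed (use keys_loop boundary_loop loop_filling \<phi> in \<open>simp_all add: eval_nat_numeral\<close>)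
qed

end



section \<open>Embedding a finite abelian group into conormal homology\<close>

theorem mainTheorem5:
  fixes A :: "('a, 'b) monoid_scheme"
  assumes "comm_group A" and "finite (carrier A)"
  shows "\<exists>X :: (nat \<Rightarrow> real) corner_data.
    compact_manifold_with_embedded_corners X \<and> all_faces_connected X \<and>
    (\<exists>S. subgroup S (conormal_homology X) \<and> (conormal_homology X)\<lparr>carrier := S\<rparr> \<cong> A)"
proof -
  interpret A: comm_group A by fact
  obtain e where e: "bij_betw e A.cells {1..card A.cells}"
    "\<And>c d. c \<in> A.cells \<Longrightarrow> d \<in> A.cells \<Longrightarrow> cell_dim c < cell_dim d \<Longrightarrow> e c < e d"
    using exists_monotone_numbering[OF A.finite_cells[OF assms(2)], of cell_dim] by blast
  define adj where "adj i j \<longleftrightarrow>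
    (\<exists>c\<in>A.cells. \<exists>d\<in>A.cells. (A.incident c d \<or> A.incident d c) \<and> i = e c \<and> j = e d)" for i j
  \<comment> \<open>Pairwise incident cells have different dimensions, and only three dimensions occur.\<close>
  have "\<not> clique adj J" if "card J = 4" for J
  proof
    assume J: "clique adj J"
    define D where "D i = cell_dim (inv_into A.cells e i)" for i
    have "D i \<noteq> D j" if "i \<in> J" "j \<in> J" "i \<noteq> j" for i j
    proof -
      obtain c d where "c \<in> A.cells" "d \<in> A.cells" "A.incident c d \<or> A.incident d c" "i = e c" "j = e d"
        using J \<open>i \<in> J\<close> \<open>j \<in> J\<close> \<open>i \<noteq> j\<close> unfolding clique_def adj_def by blast
      moreover have "inj_on e A.cells" using e(1) by (simp add: bij_betw_def)
      ultimately show ?thesis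
        using A.incident_imp_dim_less[of c d] A.incident_imp_dim_less[of d c] by (auto simp: D_def)
    qed
    then have "card (D ` J) = 4" using \<open>card J = 4\<close> by (metis card_image inj_onI)
    moreover have "D ` J \<subseteq> {..2}" using A.cell_dim_le_2 by (auto simp: D_def)
    then have "card (D ` J) \<le> card {..2 :: nat}" by (intro card_mono) auto
    ultimately show False by simp
  qed
  moreover have "adj j i" if "adj i j" for i j using that unfolding adj_def by blast
  ultimately obtain X :: "(nat \<Rightarrow> real) corner_data"
    where X: "compact_manifold_with_embedded_corners X" "all_faces_connected X" "num X = card A.cells"
      "\<And>J. J \<subseteq> {1..card A.cells} \<Longrightarrow> face X J \<noteq> {} \<longleftrightarrow> J \<in> triangle_complex adj"
    using exists_corners_with_triangle_complex[of adj "card A.cells"] by metis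
  interpret classifying_corners A e X
  proof
    show "bij_betw e A.cells {1..num X}" using e(1) X(3) by simp
    show "\<And>c d. c \<in> A.cells \<Longrightarrow> d \<in> A.cells \<Longrightarrow> cell_dim c < cell_dim d \<Longrightarrow> e c < e d" by (rule e(2))
    show "\<And>J. J \<subseteq> {1..num X} \<Longrightarrow> (face X J \<noteq> {}) = (J \<in> triangle_complex
      (\<lambda>i j. \<exists>c\<in>A.cells. \<exists>d\<in>A.cells. (A.incident c d \<or> A.incident d c) \<and> i = e c \<and> j = e d))"
      using X(3,4) unfolding adj_def[abs_def] by simp
  qed
  show ?thesis using X(1,2) group_embeds_in_conormal_homology by blast
qed

end
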